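(* The accumulated local effects (ALE) decomposition is an interaction decomposition. That is, with $$\mathcal{L}_{J,\mathrm{ALE}}(g)(\mathbf{x}_J):=\int_{\substack{x_{\min,j}<z_j<x_j,\\ j\in J}}\mathbb{E}\left[\frac{\partial g}{\partial\mathbf{x}_J}(\mathbf{X}_D)\,\middle|\,\mathbf{X}_J=\mathbf{z}_J\right]d\mathbf{z}_J\qquad(\emptyset\neq J\subseteq D,\ g\in V_D),$$ the family of linear operators $\{\mathcal{H}_{J,\mathrm{ALE}}:V_D\to V_J\}_{J\subseteq D}$ defined recursively by $$\mathcal{H}_{\emptyset,\mathrm{ALE}}:=\mathbb{E},\qquad \mathcal{H}_{J,\mathrm{ALE}}:=\Big(I-\sum_{J'\subsetneq J}\mathcal{H}_{J',\mathrm{ALE}}\Big)\circ\mathcal{L}_{J,\mathrm{ALE}}\quad(J\neq\emptyset)$$ is an interaction decomposition.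
   Context: Setting. Let $d\ge1$, $D=\{1,\dots,d\}$, and let $\mathbf{X}_D=(X_1,\dots,X_d)$ be a random vector of real feature variables (possibly dependent) with compactly supported distributions; the variable $x_j$ ranges over a compact interval $\mathcal{X}_j=[x_{\min,j},x_{\max,j}]$ containing the values of $X_j$, with $x_{\min,j}$ the minimum value $X_j$ can take. Put $\mathbf{x}_J=(x_j)_{j\in J}$ and $\setminus J:=D\setminus J$. The functions considered are sufficiently differentiable: $V_D$ is a real vector space of bounded measurable functions on $\prod_{j\in D}\mathcal{X}_j$, containing the constants, such that for every $g\in V_D$ and every $J=\{j_1,\dots,j_{|J|}\}\subseteq D$: the mixed partial derivative $\frac{\partial g}{\partial\mathbf{x}_J}=\frac{\partial^{|J|}g}{\partial x_{j_1}\cdots\partial x_{j_{|J|}}}$ exists (in any order of differentiation) and is continuous; $V_D$ is closed under substituting constants for some of the variables; $\mathcal{L}_{J,\mathrm{ALE}}(g)$ ($J\ne\emptyset$) and $\mathbb{E}_{\mathbf{X}_{\setminus J}}(g)$ (defined below) are well defined and belong to $V_D$; and integrals and partial differentiations with respect to $\mathbf{x}_J$ are exchangeable with $\mathbb{E}_{\mathbf{X}_{\setminus J}}$. For $J\subseteq D$, $V_J\subseteq V_D$ is the subspace of functions depending only on $\mathbf{x}_J$, and $V_\emptyset=\mathbb{R}$; operators $V_D\to V_J$ and $V_D\to V_{J'}$ can be composed because $V_J\subseteq V_D$. In this setting "$\frac{\partial g}{\partial\mathbf{x}_J}=0$" has its usual meaning; it is equivalent to $\sum_{J'\subseteq J}(-1)^{|J'|}g|_{\mathbf{x}_{J'}=\mathbf{a}_{J'}}=0$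 identically for all $\mathbf{a}_J\in\prod_{j\in J}\mathcal{X}_j$, where $|$ denotes substitution. Conditional expectations are computed with a fixed regular conditional distribution $\kappa_J(\mathbf{z}_J,\cdot)$ of $\mathbf{X}_{\setminus J}$ given $\mathbf{X}_J=\mathbf{z}_J$, defined for all $\mathbf{z}_J\in\prod_{j\in J}\mathcal{X}_j$: $\mathbb{E}[\varphi(\mathbf{X}_D)\mid\mathbf{X}_J=\mathbf{z}_J]=\int\varphi(\mathbf{z}_J,\mathbf{y})\,\kappa_J(\mathbf{z}_J,d\mathbf{y})$; when $X_1,\dots,X_d$ are independent, $\kappa_J(\mathbf{z}_J,\cdot)$ is the unconditional law of $\mathbf{X}_{\setminus J}$. Operators. $I$ is the identity of $V_D$; $\mathbb{E}(g)=\mathbb{E}[g(\mathbf{X}_D)]$; $\mathbb{E}_{\mathbf{X}_{\setminus J}}(g)(\mathbf{x}_J)=\mathbb{E}[g(\mathbf{x}_J,\mathbf{X}_{\setminus J})]$ (expectation over the marginal law of $\mathbf{X}_{\setminus J}$). A family of linear operators $\{\mathcal{H}_J:V_D\to V_J\}_{J\subseteq D}$ is an interaction decomposition (ID) if: (P1) Unbiasedness: $\mathcal{H}_\emptyset=\mathbb{E}$ and $\mathbb{E}\circ\mathcal{H}_J=0$ for $J\neq\emptyset$. (P2) Relevance: for $g\in V_D$, if $\frac{\partial g}{\partial\mathbf{x}_J}=0$, then $\mathcal{H}_J(g)=0$. (P3) Lean Decomposability: if $g\in V_J$, then $\big(\sum_{J'\subseteq J}\mathcal{H}_{J'}\big)(g)=g$.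 (P4) Idempotence: $\mathcal{H}_J\circ\mathcal{H}_J=\mathcal{H}_J$. (P5) Operational Orthogonality: if $J'\neq J$, then $\mathcal{H}_{J'}\circ\mathcal{H}_J=0$. (P6) Consistency with PD: when all feature variables $X_1,\dots,X_d$ are independent, $\sum_{J'\subseteq J}\mathcal{H}_{J'}=\mathbb{E}_{\mathbf{X}_{\setminus J}}$. Each is required for all $J,J'\subseteq D$. *)

theory Defs
  imports "HOL-Probability.Probability"
begin

text \<open>
  Points \<open>x\<^sub>J\<close> are extensional functions on the index set \<open>J\<close>, so that the library's product
  measures, \<^const>\<open>merge\<close> and the product topology apply. A function on the full product of
  intervals is represented by its extension by 0 to the whole type; hence equality of
  representatives is equality of functions on the product.
\<close>

locale feature_model = prob_space M for M :: "'a measure" +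
  fixes d :: nat
    and X :: "'a \<Rightarrow> nat \<Rightarrow> real"
    and xmin xmax :: "nat \<Rightarrow> real"
    and \<kappa> :: "nat set \<Rightarrow> (nat \<Rightarrow> real) \<Rightarrow> (nat \<Rightarrow> real) measure"
begin

abbreviation D :: "nat set" where
  "D \<equiv> {1..d}"

abbreviation \<X> :: "nat \<Rightarrow> real set" where
  "\<X> j \<equiv> {xmin j..xmax j}"

definition rect :: "nat set \<Rightarrow> (nat \<Rightarrow> real) set" where
  "rect J = (\<Pi>\<^sub>E j\<in>J. \<X> j)"

definition on_rect :: "((nat \<Rightarrow> real) \<Rightarrow> real) \<Rightarrow> (nat \<Rightarrow> real) \<Rightarrow> real" where
  "on_rect f = (\<lambda>x. if x \<in> rect D then f x else 0)"

abbreviation independent_features :: bool where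
  "independent_features \<equiv> indep_vars (\<lambda>_. borel) (\<lambda>j \<omega>. X \<omega> j) D"

text \<open>
  Differentiation is relative to the interval, hence one-sided at its end points.
\<close>

definition pdiff :: "nat \<Rightarrow> ((nat \<Rightarrow> real) \<Rightarrow> real) \<Rightarrow> (nat \<Rightarrow> real) \<Rightarrow> real" where
  "pdiff j g = on_rect (\<lambda>x. vector_derivative (\<lambda>t. g (x(j := t))) (at (x j) within \<X> j))"

definition pdiffs :: "nat list \<Rightarrow> ((nat \<Rightarrow> real) \<Rightarrow> real) \<Rightarrow> (nat \<Rightarrow> real) \<Rightarrow> real" where
  "pdiffs js g = foldr pdiff js g"

text \<open>
  Choosing the increasing order of differentiation is immaterial for the functions considered:
  their mixed derivatives in all orders are continuous, so the orders agree.
\<close>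

definition mixed_diff :: "nat set \<Rightarrow> ((nat \<Rightarrow> real) \<Rightarrow> real) \<Rightarrow> (nat \<Rightarrow> real) \<Rightarrow> real" where
  "mixed_diff J g = pdiffs (sorted_list_of_set J) g"

definition mean :: "((nat \<Rightarrow> real) \<Rightarrow> real) \<Rightarrow> (nat \<Rightarrow> real) \<Rightarrow> real" where
  "mean g = on_rect (\<lambda>_. expectation (\<lambda>\<omega>. g (X \<omega>)))"

text \<open>
  \<open>marg_mean J\<close> averages over the variables outside \<open>J\<close>.
\<close>

definition marg_mean :: "nat set \<Rightarrow> ((nat \<Rightarrow> real) \<Rightarrow> real) \<Rightarrow> (nat \<Rightarrow> real) \<Rightarrow> real" where
  "marg_mean J g = on_rect (\<lambda>x. expectation (\<lambda>\<omega>. g (override_on (X \<omega>) x J)))"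

definition cond_mean :: "nat set \<Rightarrow> ((nat \<Rightarrow> real) \<Rightarrow> real) \<Rightarrow> (nat \<Rightarrow> real) \<Rightarrow> real" where
  "cond_mean J \<phi> z = (\<integral>y. \<phi> (merge J (D - J) (z, y)) \<partial>\<kappa> J z)"

definition L_ALE :: "nat set \<Rightarrow> ((nat \<Rightarrow> real) \<Rightarrow> real) \<Rightarrow> (nat \<Rightarrow> real) \<Rightarrow> real" where
  "L_ALE J g = on_rect (\<lambda>x.
     LINT z : (\<Pi>\<^sub>E j\<in>J. {xmin j<..<x j}) | (\<Pi>\<^sub>M j\<in>J. lborel). cond_mean J (mixed_diff J g) z)"

text \<open>
  The recursion is meant for \<open>J \<subseteq> D\<close>; infinite \<open>J\<close> get a dummy value to ensure termination.
\<close>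

function H_ALE :: "nat set \<Rightarrow> ((nat \<Rightarrow> real) \<Rightarrow> real) \<Rightarrow> (nat \<Rightarrow> real) \<Rightarrow> real" where
  "H_ALE J g =
     (if J = {} then mean g
      else if finite J then (\<lambda>x. L_ALE J g x - (\<Sum>J' | J' \<subset> J. H_ALE J' (L_ALE J g) x))
      else (\<lambda>_. 0))"
  by pat_completeness auto
termination
  by (relation "Wellfounded.measure (\<lambda>(J, g). card J)") (auto intro: psubset_card_mono)

declare H_ALE.simps [simp del]

text \<open>
  Integral over \<open>xmin j < z j < x j\<close>, \<open>j \<in> J\<close>, of a function of all variables, those outside
  \<open>J\<close> being kept fixed.
\<close>

definition integ :: "nat set \<Rightarrow> ((nat \<Rightarrow> real) \<Rightarrow> real) \<Rightarrow> (nat \<Rightarrow> real) \<Rightarrow> real" where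
  "integ J g = on_rect (\<lambda>x.
     LINT z : (\<Pi>\<^sub>E j\<in>J. {xmin j<..<x j}) | (\<Pi>\<^sub>M j\<in>J. lborel). g (override_on x z J))"

end

locale ale_setting = feature_model M d X xmin xmax \<kappa>
  for M :: "'a measure" and d X xmin xmax \<kappa> +
  fixes V :: "((nat \<Rightarrow> real) \<Rightarrow> real) set"
  assumes d_pos: "d \<ge> 1"
    \<comment> \<open>a one-point interval would leave derivatives undetermined\<close>
    and xmin_less_xmax: "\<And>j. j \<in> D \<Longrightarrow> xmin j < xmax j"
    and random_vector: "X \<in> M \<rightarrow>\<^sub>M (\<Pi>\<^sub>M j\<in>D. borel)"
    and X_in_rect: "AE \<omega> in M. X \<omega> \<in> rect D"
    and xmin_minimal: "\<And>j e. j \<in> D \<Longrightarrow> e > 0 \<Longrightarrow> prob {\<omega> \<in> space M. X \<omega> j < xmin j + e} > 0"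

    \<comment> \<open>\<open>\<kappa> J\<close> is a version of the conditional law of the variables outside \<open>J\<close> given those in \<open>J\<close>\<close>
    and kernel: "\<And>J. J \<subseteq> D \<Longrightarrow>
      \<kappa> J \<in> restrict_space (\<Pi>\<^sub>M j\<in>J. borel) (rect J) \<rightarrow>\<^sub>M prob_algebra (\<Pi>\<^sub>M j\<in>D - J. borel)"
    and kernel_rect: "\<And>J z. J \<subseteq> D \<Longrightarrow> z \<in> rect J \<Longrightarrow> AE y in \<kappa> J z. y \<in> rect (D - J)"
    and kernel_conditional: "\<And>J A B. J \<subseteq> D \<Longrightarrow>
      A \<in> sets (restrict_space (\<Pi>\<^sub>M j\<in>J. borel) (rect J)) \<Longrightarrow> B \<in> sets (\<Pi>\<^sub>M j\<in>D - J. borel) \<Longrightarrow>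
      prob {\<omega> \<in> space M. restrict (X \<omega>) J \<in> A \<and> restrict (X \<omega>) (D - J) \<in> B} =
      expectation (\<lambda>\<omega>. indicator A (restrict (X \<omega>) J) * measure (\<kappa> J (restrict (X \<omega>) J)) B)"
    and kernel_independent: "\<And>J z. independent_features \<Longrightarrow> J \<subseteq> D \<Longrightarrow> z \<in> rect J \<Longrightarrow>
      \<kappa> J z = distr M (\<Pi>\<^sub>M j\<in>D - J. borel) (\<lambda>\<omega>. restrict (X \<omega>) (D - J))"

    and V_outside: "\<And>g x. g \<in> V \<Longrightarrow> x \<notin> rect D \<Longrightarrow> g x = 0"
    and V_measurable: "\<And>g. g \<in> V \<Longrightarrow> g \<in> borel_measurable (\<Pi>\<^sub>M j\<in>D. borel)"
    and V_bounded: "\<And>g. g \<in> V \<Longrightarrow> bounded (range g)"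
    and V_const: "\<And>c. on_rect (\<lambda>_. c) \<in> V"
    and V_add: "\<And>g h. g \<in> V \<Longrightarrow> h \<in> V \<Longrightarrow> (\<lambda>x. g x + h x) \<in> V"
    and V_scale: "\<And>c g. g \<in> V \<Longrightarrow> (\<lambda>x. c * g x) \<in> V"
    and V_differentiable: "\<And>g js j x. g \<in> V \<Longrightarrow> distinct (j # js) \<Longrightarrow> set (j # js) \<subseteq> D \<Longrightarrow>
      x \<in> rect D \<Longrightarrow> (\<lambda>t. pdiffs js g (x(j := t))) differentiable (at (x j) within \<X> j)"
    and V_continuous: "\<And>g js. g \<in> V \<Longrightarrow> distinct js \<Longrightarrow> set js \<subseteq> D \<Longrightarrow>
      continuous_on (rect D) (pdiffs js g)"
    and V_subst: "\<And>g J a. g \<in> V \<Longrightarrow> J \<subseteq> D \<Longrightarrow> a \<in> rect J \<Longrightarrow>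
      on_rect (\<lambda>x. g (override_on x a J)) \<in> V"
    and V_L_ALE: "\<And>g J. g \<in> V \<Longrightarrow> J \<subseteq> D \<Longrightarrow> J \<noteq> {} \<Longrightarrow> L_ALE J g \<in> V"
    and V_marg_mean: "\<And>g J. g \<in> V \<Longrightarrow> J \<subseteq> D \<Longrightarrow> marg_mean J g \<in> V"
    and diff_exchange: "\<And>g J. g \<in> V \<Longrightarrow> J \<subseteq> D \<Longrightarrow>
      mixed_diff J (marg_mean J g) = marg_mean J (mixed_diff J g)"
    and integ_exchange: "\<And>g h J. g \<in> V \<Longrightarrow> J \<subseteq> D \<Longrightarrow> h \<in> {g, mixed_diff J g} \<Longrightarrow>
      integ J (marg_mean J h) = marg_mean J (integ J h)"
begin

definition V_on :: "nat set \<Rightarrow> ((nat \<Rightarrow> real) \<Rightarrow> real) set" where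
  "V_on J = {g \<in> V. \<forall>x\<in>rect D. \<forall>y\<in>rect D. (\<forall>j\<in>J. x j = y j) \<longrightarrow> g x = g y}"

definition linear_family ::
  "(nat set \<Rightarrow> ((nat \<Rightarrow> real) \<Rightarrow> real) \<Rightarrow> (nat \<Rightarrow> real) \<Rightarrow> real) \<Rightarrow> bool" where
  "linear_family H \<longleftrightarrow> (\<forall>J\<subseteq>D.
     (\<forall>g\<in>V. H J g \<in> V_on J) \<and>
     (\<forall>g\<in>V. \<forall>h\<in>V. H J (\<lambda>x. g x + h x) = (\<lambda>x. H J g x + H J h x)) \<and>
     (\<forall>c. \<forall>g\<in>V. H J (\<lambda>x. c * g x) = (\<lambda>x. c * H J g x)))"

definition unbiased ::
  "(nat set \<Rightarrow> ((nat \<Rightarrow> real) \<Rightarrow> real) \<Rightarrow> (nat \<Rightarrow> real) \<Rightarrow> real) \<Rightarrow> bool" where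
  "unbiased H \<longleftrightarrow> (\<forall>g\<in>V. H {} g = mean g) \<and>
     (\<forall>J\<subseteq>D. J \<noteq> {} \<longrightarrow> (\<forall>g\<in>V. mean (H J g) = (\<lambda>_. 0)))"

definition relevant ::
  "(nat set \<Rightarrow> ((nat \<Rightarrow> real) \<Rightarrow> real) \<Rightarrow> (nat \<Rightarrow> real) \<Rightarrow> real) \<Rightarrow> bool" where
  "relevant H \<longleftrightarrow>
     (\<forall>J\<subseteq>D. \<forall>g\<in>V. (\<forall>x\<in>rect D. mixed_diff J g x = 0) \<longrightarrow> H J g = (\<lambda>_. 0))"

definition lean_decomposable ::
  "(nat set \<Rightarrow> ((nat \<Rightarrow> real) \<Rightarrow> real) \<Rightarrow> (nat \<Rightarrow> real) \<Rightarrow> real) \<Rightarrow> bool" where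
  "lean_decomposable H \<longleftrightarrow>
     (\<forall>J\<subseteq>D. \<forall>g\<in>V_on J. (\<lambda>x. \<Sum>J' | J' \<subseteq> J. H J' g x) = g)"

definition idempotent_family ::
  "(nat set \<Rightarrow> ((nat \<Rightarrow> real) \<Rightarrow> real) \<Rightarrow> (nat \<Rightarrow> real) \<Rightarrow> real) \<Rightarrow> bool" where
  "idempotent_family H \<longleftrightarrow> (\<forall>J\<subseteq>D. \<forall>g\<in>V. H J (H J g) = H J g)"

definition operationally_orthogonal ::
  "(nat set \<Rightarrow> ((nat \<Rightarrow> real) \<Rightarrow> real) \<Rightarrow> (nat \<Rightarrow> real) \<Rightarrow> real) \<Rightarrow> bool" where
  "operationally_orthogonal H \<longleftrightarrow>
     (\<forall>J\<subseteq>D. \<forall>J'\<subseteq>D. J' \<noteq> J \<longrightarrow> (\<forall>g\<in>V. H J' (H J g) = (\<lambda>_. 0)))"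

definition consistent_with_PD ::
  "(nat set \<Rightarrow> ((nat \<Rightarrow> real) \<Rightarrow> real) \<Rightarrow> (nat \<Rightarrow> real) \<Rightarrow> real) \<Rightarrow> bool" where
  "consistent_with_PD H \<longleftrightarrow> (independent_features \<longrightarrow>
     (\<forall>J\<subseteq>D. \<forall>g\<in>V. (\<lambda>x. \<Sum>J' | J' \<subseteq> J. H J' g x) = marg_mean J g))"

definition interaction_decomposition ::
  "(nat set \<Rightarrow> ((nat \<Rightarrow> real) \<Rightarrow> real) \<Rightarrow> (nat \<Rightarrow> real) \<Rightarrow> real) \<Rightarrow> bool" where
  "interaction_decomposition H \<longleftrightarrow>
     linear_family H \<and> unbiased H \<and> relevant H \<and> lean_decomposable H \<and>
     idempotent_family H \<and> operationally_orthogonal H \<and> consistent_with_PD H"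

end

end

theory Submission
  imports Defs
begin

text \<open>
  If \<open>g\<close> depends only on \<open>x\<^sub>J\<close>, so does its mixed derivative; the conditional expectation is then
  trivial, and by Fubini and the fundamental theorem of calculus \<open>L_ALE J g\<close> is \<open>g\<close> minus functions
  that each miss a variable of \<open>J\<close>. Together with relevance, which is immediate because \<open>L_ALE J g\<close>
  vanishes with the mixed derivative, this yields lean decomposability by induction on \<open>J\<close>.
  Lean decomposability gives \<open>H_ALE J g = H_ALE J (L_ALE J g)\<close> and hence, by induction again,
  idempotence and orthogonality; unbiasedness is orthogonality for \<open>J' = {}\<close>. For independent
  features, \<open>L_ALE K\<close> cannot distinguish \<open>g\<close> from \<open>marg_mean J g\<close> when \<open>K \<subseteq> J\<close>, so lean
  decomposability of \<open>marg_mean J g\<close> gives consistency with partial dependence.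
\<close>

section \<open>Mixed derivatives on the product of intervals\<close>

context feature_model
begin

lemma on_rect_in [simp]: "x \<in> rect D \<Longrightarrow> on_rect f x = f x"
  and on_rect_out [simp]: "x \<notin> rect D \<Longrightarrow> on_rect f x = 0"
  by (simp_all add: on_rect_def)

lemma rectD: "x \<in> rect J \<Longrightarrow> j \<in> J \<Longrightarrow> x j \<in> \<X> j"
  by (auto simp: rect_def)

lemma rect_upd: "x \<in> rect D \<Longrightarrow> j \<in> D \<Longrightarrow> t \<in> \<X> j \<Longrightarrow> x(j := t) \<in> rect D"
  by (auto simp: rect_def PiE_iff extensional_def)

lemma rect_override:
  "y \<in> rect D \<Longrightarrow> J \<subseteq> D \<Longrightarrow> (\<And>j. j \<in> J \<Longrightarrow> z j \<in> \<X> j) \<Longrightarrow> override_on y z J \<in> rect D"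
  by (auto simp: rect_def PiE_iff extensional_def override_on_def subset_iff)

lemma rect_override_rect: "x \<in> rect D \<Longrightarrow> y \<in> rect D \<Longrightarrow> override_on y x J \<in> rect D"
  by (auto simp: rect_def PiE_iff extensional_def override_on_def)

lemma rect_merge:
  "J \<subseteq> D \<Longrightarrow> z \<in> rect J \<Longrightarrow> y \<in> rect (D - J) \<Longrightarrow> merge J (D - J) (z, y) \<in> rect D"
  by (auto simp: rect_def PiE_iff extensional_def merge_def)

lemma rect_borel [measurable]: "finite J \<Longrightarrow> rect J \<in> sets (\<Pi>\<^sub>M j\<in>J. borel)"
  unfolding rect_def by (rule sets_PiM_I_finite) auto

lemma compact_rect: "compact (rect D)"
proof -
  \<comment> \<open>Points of \<open>rect D\<close> equal \<open>undefined\<close> outside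
    \<open>D\<close>, so \<open>rect D\<close> is a product over all of \<open>nat\<close> with
    singleton factors there, and Tychonoff's theorem applies.\<close>
  have eq: "rect D = (\<Pi>\<^sub>E j\<in>UNIV. if j \<in> D then \<X> j else {undefined})"
    by (force simp: rect_def PiE_iff extensional_def split: if_splits)
  have "compactin (product_topology (\<lambda>_. euclidean) UNIV) (rect D)"
    unfolding eq compactin_PiE by auto
  then show ?thesis
    by (simp add: euclidean_product_topology)
qed

text \<open>Continuity refers to the topology of the full function space, measurability to the
  product over \<open>D\<close>. The inclusion between the two is measurable because coordinates
  outside \<open>D\<close> are constant, so a continuous function on the Borel set
  \<open>rect D\<close>, extended by 0, is measurable.\<close>

lemma continuous_on_rect_measurable:
  fixes f :: "(nat \<Rightarrow> real) \<Rightarrow> real"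
  assumes "continuous_on (rect D) f" and out: "\<And>x. x \<notin> rect D \<Longrightarrow> f x = 0"
  shows "f \<in> borel_measurable (\<Pi>\<^sub>M j\<in>D. borel)"
proof -
  have "(\<lambda>x. x) \<in> borel_measurable (\<Pi>\<^sub>M j\<in>D. (borel :: real measure))"
  proof (rule measurable_coordinatewise_then_product)
    fix i
    show "(\<lambda>x. x i) \<in> borel_measurable (\<Pi>\<^sub>M j\<in>D. (borel :: real measure))"
    proof (cases "i \<in> D")
      case False
      then have "(\<lambda>x. x i) \<in> borel_measurable (\<Pi>\<^sub>M j\<in>D. (borel :: real measure)) \<longleftrightarrow>
          (\<lambda>x. undefined :: real) \<in> borel_measurable (\<Pi>\<^sub>M j\<in>D. (borel :: real measure))"
        by (intro measurable_cong) (auto simp: space_PiM PiE_iff extensional_def)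
      then show ?thesis by simp
    qed (rule measurable_component_singleton)
  qed
  then have "(\<lambda>x. x) \<in> restrict_space (\<Pi>\<^sub>M j\<in>D. (borel :: real measure)) (rect D) \<rightarrow>\<^sub>M restrict_space borel (rect D)"
    by (intro measurable_restrict_space3) auto
  moreover have "f \<in> borel_measurable (restrict_space borel (rect D))"
    by (rule borel_measurable_continuous_on_restrict) fact
  ultimately have "f \<in> borel_measurable (restrict_space (\<Pi>\<^sub>M j\<in>D. borel) (rect D))"
    by (rule measurable_compose)
  then have "(\<lambda>x. indicator (rect D) x *\<^sub>R f x) \<in> borel_measurable (\<Pi>\<^sub>M j\<in>D. borel)"
    by (subst (asm) borel_measurable_restrict_space_iff) auto
  also have "(\<lambda>x. indicator (rect D) x *\<^sub>R f x) = f"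
    using out by (force simp: indicator_def fun_eq_iff)
  finally show ?thesis .
qed

text \<open>The dependence condition of \<open>V_on\<close> without membership in \<open>V\<close>,
  because mixed derivatives need not lie in \<open>V\<close>.\<close>

definition depends_on :: "nat set \<Rightarrow> ((nat \<Rightarrow> real) \<Rightarrow> real) \<Rightarrow> bool" where
  "depends_on J g \<longleftrightarrow> (\<forall>x\<in>rect D. \<forall>y\<in>rect D. (\<forall>j\<in>J. x j = y j) \<longrightarrow> g x = g y)"

lemma depends_onD:
  "depends_on J g \<Longrightarrow> x \<in> rect D \<Longrightarrow> y \<in> rect D \<Longrightarrow> (\<And>j. j \<in> J \<Longrightarrow> x j = y j) \<Longrightarrow> g x = g y"
  unfolding depends_on_def by blast

lemma depends_onI:
  "(\<And>x y. x \<in> rect D \<Longrightarrow> y \<in> rect D \<Longrightarrow> (\<And>j. j \<in> J \<Longrightarrow> x j = y j) \<Longrightarrow> g x = g y) \<Longrightarrow> depends_on J g"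
  unfolding depends_on_def by blast

lemma depends_on_mono: "depends_on J g \<Longrightarrow> J \<subseteq> K \<Longrightarrow> depends_on K g"
  unfolding depends_on_def by blast

lemma pdiff_out: "x \<notin> rect D \<Longrightarrow> pdiff j g x = 0"
  by (simp add: pdiff_def)

text \<open>The boundary difference that arises when \<open>pdiff j g\<close> is integrated from
  \<open>xmin j\<close> to \<open>x j\<close>; its iterates replace the inclusion-exclusion sum over
  subsets of \<open>J\<close>.\<close>

definition bdiff :: "nat \<Rightarrow> ((nat \<Rightarrow> real) \<Rightarrow> real) \<Rightarrow> (nat \<Rightarrow> real) \<Rightarrow> real" where
  "bdiff j g = on_rect (\<lambda>x. g x - g (x(j := xmin j)))"

lemma pdiffs_Nil [simp]: "pdiffs [] g = g"
  and pdiffs_Cons [simp]: "pdiffs (j # js) g = pdiff j (pdiffs js g)"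
  by (simp_all add: pdiffs_def)

text \<open>\<open>vector_derivative\<close> chooses one of the possible derivatives. Functions that
  agree on \<open>S\<close> have the same ones, so the choices coincide even where no derivative
  exists.\<close>

lemma vector_derivative_within_cong:
  fixes f g :: "real \<Rightarrow> real"
  assumes "t \<in> S" "\<And>s. s \<in> S \<Longrightarrow> f s = g s"
  shows "vector_derivative f (at t within S) = vector_derivative g (at t within S)"
proof -
  have "(f has_vector_derivative c) (at t within S) \<longleftrightarrow> (g has_vector_derivative c) (at t within S)" for c
    using assms has_vector_derivative_transform[of t S f g c] has_vector_derivative_transform[of t S g f c]
    by auto
  then show ?thesis
    by (simp add: vector_derivative_def)
qed

lemma pdiff_depends_on:
  assumes "depends_on K g" "j \<in> D"
  shows "depends_on K (pdiff j g)"
proof (rule depends_onI)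
  fix x y assume xy: "x \<in> rect D" "y \<in> rect D" "\<And>i. i \<in> K \<Longrightarrow> x i = y i"
  show "pdiff j g x = pdiff j g y"
  proof (cases "j \<in> K")
    case True
    have "vector_derivative (\<lambda>t. g (x(j := t))) (at (x j) within \<X> j) =
        vector_derivative (\<lambda>t. g (y(j := t))) (at (x j) within \<X> j)"
      using xy assms rectD[OF xy(1)]
      by (intro vector_derivative_within_cong depends_onD[OF assms(1)] rect_upd) auto
    then show ?thesis using xy True by (simp add: pdiff_def)
  next
    case False
    have "vector_derivative (\<lambda>t. g (x(j := t))) (at (x j) within \<X> j) =
        vector_derivative (\<lambda>t. g x) (at (x j) within \<X> j)"
      using xy assms rectD[OF xy(1)] False
      by (intro vector_derivative_within_cong depends_onD[OF assms(1)] rect_upd) auto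
    moreover have "vector_derivative (\<lambda>t. g (y(j := t))) (at (y j) within \<X> j) =
        vector_derivative (\<lambda>t. g x) (at (y j) within \<X> j)"
      using xy assms rectD[OF xy(2)] False
      by (intro vector_derivative_within_cong depends_onD[OF assms(1)] rect_upd) auto
    moreover have "vector_derivative (\<lambda>t. g x) (at s within \<X> j) = 0" if "s \<in> \<X> j" "xmin j < xmax j" for s
      using that by (intro vector_derivative_within_closed_interval) auto
    \<comment> \<open>On a one-point interval the derivative is an arbitrary value, but then
      \<open>x j = y j\<close> makes both sides the same one.\<close>
    moreover have "xmin j = xmax j" if "\<not> xmin j < xmax j"
      using that rectD[OF xy(1) assms(2)] by auto
    ultimately show ?thesis using xy rectD[OF xy(1) assms(2)] rectD[OF xy(2) assms(2)]
      by (cases "xmin j < xmax j") (auto simp: pdiff_def)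
  qed
qed

lemma pdiffs_depends_on: "depends_on K g \<Longrightarrow> set js \<subseteq> D \<Longrightarrow> depends_on K (pdiffs js g)"
  by (induction js) (simp_all add: pdiff_depends_on)

lemma mixed_diff_depends_on: "depends_on K g \<Longrightarrow> J \<subseteq> D \<Longrightarrow> depends_on K (mixed_diff J g)"
  unfolding mixed_diff_def using finite_subset[of J D] by (intro pdiffs_depends_on) auto

end

section \<open>Mixed derivatives of functions in \<open>V\<close>\<close>

context ale_setting
begin

lemma pdiff_eqI:
  assumes "x \<in> rect D" "j \<in> D"
    and "((\<lambda>t. g (x(j := t))) has_vector_derivative c) (at (x j) within \<X> j)"
  shows "pdiff j g x = c"
  using assms(1) vector_derivative_within_closed_interval[OF xmin_less_xmax[OF assms(2)] rectD[OF assms(1,2)] assms(3)]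
  by (simp add: pdiff_def)

lemma pdiff_eq_0:
  assumes "depends_on K g" "j \<in> D" "j \<notin> K"
  shows "pdiff j g = (\<lambda>_. 0)"
proof
  fix x show "pdiff j g x = 0"
  proof (cases "x \<in> rect D")
    case True
    have "((\<lambda>t. g (x(j := t))) has_vector_derivative 0) (at (x j) within \<X> j)"
      by (rule has_vector_derivative_transform[where f = "\<lambda>_. g x"])
        (use True assms rectD[OF True assms(2)] in \<open>auto intro!: depends_onD[OF assms(1)] rect_upd\<close>)
    then show ?thesis using True assms by (intro pdiff_eqI)
  qed (simp add: pdiff_out)
qed

lemma pdiff_zero: "j \<in> D \<Longrightarrow> pdiff j (\<lambda>_. 0) = (\<lambda>_. 0)"
  by (rule pdiff_eq_0[where K = "{}"]) (auto simp: depends_on_def)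

text \<open>Differentiation preserves dependence on \<open>K\<close>, so the first derivative taken
  in a variable outside \<open>K\<close> is 0, and further derivatives of 0 stay 0.\<close>

lemma pdiffs_eq_0:
  assumes "depends_on K g" "set js \<subseteq> D" "\<not> set js \<subseteq> K"
  shows "pdiffs js g = (\<lambda>_. 0)"
  using assms
proof (induction js)
  case (Cons j js)
  show ?case
  proof (cases "set js \<subseteq> K")
    case True
    then show ?thesis using Cons by (auto intro!: pdiff_eq_0 pdiffs_depends_on)
  qed (use Cons pdiff_zero in auto)
qed auto

lemma mixed_diff_eq_0:
  assumes "depends_on K g" "J \<subseteq> D" "\<not> J \<subseteq> K"
  shows "mixed_diff J g = (\<lambda>_. 0)"
  unfolding mixed_diff_def using assms finite_subset[of J D] by (intro pdiffs_eq_0) auto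

lemma pdiffs_has_vector_derivative:
  assumes "g \<in> V" "distinct (j # js)" "set (j # js) \<subseteq> D" "x \<in> rect D" "t \<in> \<X> j"
  shows "((\<lambda>s. pdiffs js g (x(j := s))) has_vector_derivative pdiffs (j # js) g (x(j := t))) (at t within \<X> j)"
proof -
  have x': "x(j := t) \<in> rect D" using assms by (intro rect_upd) auto
  from V_differentiable[OF assms(1,2,3) x'] x' show ?thesis
    by (simp add: pdiff_def vector_derivative_works)
qed

text \<open>Derivatives add where they exist, so the induction relies on differentiability at every
  intermediate order.\<close>

lemma pdiffs_lincomb:
  assumes "g \<in> V" "h \<in> V" "distinct js" "set js \<subseteq> D"
  shows "pdiffs js (\<lambda>x. a * g x + b * h x) = (\<lambda>x. a * pdiffs js g x + b * pdiffs js h x)"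
  using assms
proof (induction js)
  case (Cons j js)
  have IH: "pdiffs js (\<lambda>x. a * g x + b * h x) = (\<lambda>x. a * pdiffs js g x + b * pdiffs js h x)"
    using Cons by auto
  show ?case
  proof
    fix x show "pdiffs (j # js) (\<lambda>x. a * g x + b * h x) x =
        a * pdiffs (j # js) g x + b * pdiffs (j # js) h x"
    proof (cases "x \<in> rect D")
      case True
      then have t: "x j \<in> \<X> j" using Cons by (intro rectD[of x D]) auto
      from pdiffs_has_vector_derivative[OF Cons(2,4,5) True t]
        pdiffs_has_vector_derivative[OF Cons(3,4,5) True t] Cons.prems True
      show ?thesis unfolding pdiffs_Cons IH
        by (intro pdiff_eqI) (auto intro!: derivative_eq_intros)
    qed (simp add: pdiff_out)
  qed
qed auto

lemma pdiffs_out: "g \<in> V \<Longrightarrow> x \<notin> rect D \<Longrightarrow> pdiffs js g x = 0"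
  by (cases js) (auto simp: pdiff_out V_outside)

lemma pdiffs_measurable:
  "g \<in> V \<Longrightarrow> distinct js \<Longrightarrow> set js \<subseteq> D \<Longrightarrow> pdiffs js g \<in> borel_measurable (\<Pi>\<^sub>M j\<in>D. borel)"
  by (intro continuous_on_rect_measurable V_continuous pdiffs_out)

lemma pdiffs_bounded:
  assumes "g \<in> V" "distinct js" "set js \<subseteq> D"
  obtains B where "\<And>x. \<bar>pdiffs js g x\<bar> \<le> B"
proof -
  have "bounded (pdiffs js g ` rect D)"
    using compact_continuous_image[OF V_continuous[OF assms] compact_rect] by (rule compact_imp_bounded)
  then obtain B where B: "\<And>x. x \<in> rect D \<Longrightarrow> \<bar>pdiffs js g x\<bar> \<le> B"
    by (auto simp: bounded_iff)
  have "\<bar>pdiffs js g x\<bar> \<le> \<bar>B\<bar>" for x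
    using B[of x] pdiffs_out[OF assms(1), of x] by (cases "x \<in> rect D") auto
  then show ?thesis using that by blast
qed

text \<open>Later inductions run over arbitrary distinct lists, so only distinctness and the
  underlying set are kept of the sorted enumeration.\<close>

lemma mixed_diff_sorted:
  assumes "J \<subseteq> D"
  obtains js where "distinct js" "set js = J" "\<And>g. mixed_diff J g = pdiffs js g"
  using assms finite_subset[of J D] by (auto simp: mixed_diff_def intro!: that[of "sorted_list_of_set J"])

lemma integral_pdiff:
  assumes "g \<in> V" "distinct (j # js)" "set (j # js) \<subseteq> D" "x \<in> rect D"
  shows "(\<integral>t. indicator {xmin j<..<x j} t * pdiffs (j # js) g (x(j := t)) \<partial>lborel) =
    pdiffs js g x - pdiffs js g (x(j := xmin j))"
proof -
  have xj: "x j \<in> \<X> j" using assms by (intro rectD[of x D]) auto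
  let ?f = "\<lambda>t. pdiffs (j # js) g (x(j := t))"
  have cont: "continuous_on {xmin j..x j} ?f"
  proof (rule continuous_on_compose2[OF V_continuous[OF assms(1-3)]])
    show "continuous_on {xmin j..x j} (\<lambda>t. x(j := t))"
    proof (rule continuous_on_coordinatewise_then_product)
      fix i show "continuous_on {xmin j..x j} (\<lambda>t. (x(j := t)) i)"
        by (cases "i = j") (auto intro: continuous_intros)
    qed
    have "x(j := t) \<in> rect D" if "t \<in> {xmin j..x j}" for t
      by (rule rect_upd[OF assms(4)]) (use assms(3) xj that in auto)
    then show "(\<lambda>t. x(j := t)) ` {xmin j..x j} \<subseteq> rect D"
      by blast
  qed
  have deriv: "((\<lambda>s. pdiffs js g (x(j := s))) has_vector_derivative ?f t) (at t within {xmin j..x j})"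
    if "xmin j \<le> t" "t \<le> x j" for t
    by (rule has_vector_derivative_within_subset[OF pdiffs_has_vector_derivative[OF assms(1-4)]])
      (use that xj in auto)
  \<comment> \<open>\<open>L_ALE\<close> integrates over open intervals, the fundamental theorem
    over closed ones; they differ by two points, a null set.\<close>
  have "(\<integral>t. indicator {xmin j<..<x j} t * ?f t \<partial>lborel) = (\<integral>t. indicator {xmin j..x j} t *\<^sub>R ?f t \<partial>lborel)"
    by (subst real_scaleR_def[symmetric],
        rule set_integral_discrete_difference[unfolded set_lebesgue_integral_def, where X = "{xmin j, x j}"]) auto
  also have "\<dots> = pdiffs js g (x(j := x j)) - pdiffs js g (x(j := xmin j))"
    by (rule integral_FTC_Icc[OF _ deriv cont]) (use xj in auto)
  finally show ?thesis by simp
qed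

end

section \<open>Integrals over boxes and conditional means\<close>

context feature_model
begin

definition box :: "nat set \<Rightarrow> (nat \<Rightarrow> real) \<Rightarrow> (nat \<Rightarrow> real) set" where
  "box J x = (\<Pi>\<^sub>E j\<in>J. {xmin j<..<x j})"

lemma box_measurable: "finite J \<Longrightarrow> box J x \<in> sets (\<Pi>\<^sub>M j\<in>J. lborel)"
  unfolding box_def by (rule sets_PiM_I_finite) auto

lemma box_subset_rect: "J \<subseteq> D \<Longrightarrow> x \<in> rect D \<Longrightarrow> box J x \<subseteq> rect J"
  unfolding box_def rect_def
proof (rule PiE_mono)
  fix j assume "J \<subseteq> D" "x \<in> Pi\<^sub>E D \<X>" "j \<in> J"
  then have "x j \<in> \<X> j" by (metis PiE_mem subsetD)
  then show "{xmin j<..<x j} \<subseteq> \<X> j" by auto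
qed

lemma emeasure_box_finite: "finite J \<Longrightarrow> emeasure (\<Pi>\<^sub>M j\<in>J. lborel) (box J x) < \<infinity>"
proof -
  assume "finite J"
  interpret product_sigma_finite "\<lambda>_::nat. lborel :: real measure" ..
  have "emeasure (lborel :: real measure) {xmin j<..<x j} \<noteq> \<infinity>" for j
    by (cases "xmin j \<le> x j") auto
  then show ?thesis
    using \<open>finite J\<close> unfolding box_def
    by (subst emeasure_PiM) (auto simp: less_top[symmetric] ennreal_prod_eq_top)
qed

lemma integrable_on_box:
  fixes f :: "(nat \<Rightarrow> real) \<Rightarrow> real"
  assumes "finite J" "f \<in> borel_measurable (\<Pi>\<^sub>M j\<in>J. lborel)" "\<And>z. z \<in> box J x \<Longrightarrow> \<bar>f z\<bar> \<le> B"
  shows "integrable (\<Pi>\<^sub>M j\<in>J. lborel) (\<lambda>z. indicator (box J x) z *\<^sub>R f z)"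
  using assms by (intro integrableI_bounded_set_indicator[where B = B] box_measurable emeasure_box_finite) auto

end

context ale_setting
begin

lemma override_measurable:
  assumes "J \<subseteq> D" "x \<in> rect D"
  shows "(\<lambda>z. override_on x z J) \<in> (\<Pi>\<^sub>M j\<in>J. lborel) \<rightarrow>\<^sub>M (\<Pi>\<^sub>M j\<in>D. borel)"
proof (rule measurable_PiM_single')
  fix i assume "i \<in> D"
  show "(\<lambda>z. override_on x z J i) \<in> borel_measurable (\<Pi>\<^sub>M j\<in>J. lborel)"
  proof (cases "i \<in> J")
    case True
    then show ?thesis using measurable_component_singleton[OF True, of "\<lambda>_. lborel :: real measure"] by simp
  qed simp
next
  show "(\<lambda>z i. override_on x z J i) \<in> space (\<Pi>\<^sub>M j\<in>J. lborel) \<rightarrow> (\<Pi>\<^sub>E i\<in>D. space borel)"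
    using assms by (auto simp: rect_def PiE_iff extensional_def override_on_def subset_iff)
qed

lemma integrable_pdiffs_box:
  assumes "g \<in> V" "distinct js" "set js \<subseteq> D" "J \<subseteq> D" "x \<in> rect D" "y \<in> rect D"
  shows "integrable (\<Pi>\<^sub>M j\<in>J. lborel) (\<lambda>z. indicator (box J y) z *\<^sub>R pdiffs js g (override_on x z J))"
proof -
  obtain B where "\<And>x. \<bar>pdiffs js g x\<bar> \<le> B"
    using pdiffs_bounded assms(1-3) by blast
  then show ?thesis
    using assms finite_subset[OF assms(4)]
    by (intro integrable_on_box[where B = B] measurable_compose[OF override_measurable pdiffs_measurable]) auto
qed

lemma integ_eq:
  "x \<in> rect D \<Longrightarrow> integ J f x = (\<integral>z. indicator (box J x) z *\<^sub>R f (override_on x z J) \<partial>(\<Pi>\<^sub>M j\<in>J. lborel))"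
  by (simp add: integ_def set_lebesgue_integral_def box_def)

text \<open>The fundamental theorem of calculus in several variables. Fubini separates the variable
  \<open>j\<close>, \<open>integral_pdiff\<close> evaluates its integral, and the two boundary
  values are integrals over \<open>set js\<close> at \<open>x\<close> and at \<open>x\<close> with
  \<open>xmin j\<close> inserted; the induction hypothesis for arbitrary \<open>x\<close> covers
  both.\<close>

lemma integ_pdiffs:
  assumes "g \<in> V" "distinct js" "set js \<subseteq> D" "x \<in> rect D"
  shows "integ (set js) (pdiffs js g) x = foldr bdiff js g x"
  using assms(2-4)
proof (induction js arbitrary: x)
  case Nil
  \<comment> \<open>Over no variables the product space has one point, the box is that point, and
    the integral is evaluation at \<open>x\<close>.\<close>
  then show ?case
    by (simp add: integ_eq box_def PiM_empty lebesgue_integral_count_space_finite)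
next
  case (Cons j js)
  interpret product_sigma_finite "\<lambda>_::nat. lborel :: real measure" ..
  let ?J = "set js" and ?x0 = "x(j := xmin j)"
  have j: "j \<in> D" "j \<notin> ?J" "?J \<subseteq> D" "distinct js" "insert j ?J \<subseteq> D" and x: "x \<in> rect D"
    using Cons.prems by auto
  have x0: "?x0 \<in> rect D"
    by (rule rect_upd[OF x j(1)]) (use xmin_less_xmax[OF j(1)] in auto)
  \<comment> \<open>The inequalities of the larger box split into those for \<open>z\<close> and the
    one for \<open>t\<close>. Membership also requires extensionality, hence the assumption on
    \<open>z\<close>.\<close>
  have ind: "indicator (box (insert j ?J) x) (z(j := t)) =
      (indicator (box ?J x) z * indicator {xmin j<..<x j} t :: real)"
    if "z \<in> space (\<Pi>\<^sub>M j\<in>?J. lborel)" for z t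
  proof -
    have "z \<in> extensional ?J" "z(j := t) \<in> extensional (insert j ?J)"
      using that by (simp_all add: space_PiM PiE_iff extensional_def)
    moreover have "(z(j := t)) i = z i" if "i \<in> ?J" for i
      using that j(2) by (metis fun_upd_other)
    ultimately have "z(j := t) \<in> box (insert j ?J) x \<longleftrightarrow> z \<in> box ?J x \<and> t \<in> {xmin j<..<x j}"
      unfolding box_def PiE_iff by (metis fun_upd_same insert_iff)
    then show ?thesis by (simp only: indicator_def of_bool_conj)
  qed
  have over: "override_on x (z(j := t)) (insert j ?J) = (override_on x z ?J)(j := t)" for z and t :: real
    using j(2) by (auto simp: override_on_def)
  have over0: "(override_on x z ?J)(j := xmin j) = override_on ?x0 z ?J" for z
    using j(2) by (auto simp: override_on_def)
  \<comment> \<open>Resetting \<open>x j\<close> leaves the region over \<open>set js\<close>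
    unchanged because \<open>j\<close> is not among its variables, so the two boundary terms share
    one region.\<close>
  have box0: "box ?J ?x0 = box ?J x"
    unfolding box_def using j(2) by (intro PiE_cong) auto
  have "integ (set (j # js)) (pdiffs (j # js) g) x =
      (\<integral>z. (\<integral>t. indicator (box (insert j ?J) x) (z(j := t)) *\<^sub>R
        pdiffs (j # js) g (override_on x (z(j := t)) (insert j ?J)) \<partial>lborel) \<partial>(\<Pi>\<^sub>M j\<in>?J. lborel))"
    unfolding integ_eq[OF x] list.set
    by (rule product_integral_insert[OF finite_set j(2) integrable_pdiffs_box[OF assms(1) Cons.prems(1,2) j(5) x x]])
  also have "\<dots> = (\<integral>z. indicator (box ?J x) z *\<^sub>R pdiffs js g (override_on x z ?J) -
      indicator (box ?J x) z *\<^sub>R pdiffs js g (override_on ?x0 z ?J) \<partial>(\<Pi>\<^sub>M j\<in>?J. lborel))"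
  proof (rule Bochner_Integration.integral_cong[OF refl])
    fix z :: "nat \<Rightarrow> real" assume z: "z \<in> space (\<Pi>\<^sub>M j\<in>?J. lborel)"
    show "(\<integral>t. indicator (box (insert j ?J) x) (z(j := t)) *\<^sub>R
        pdiffs (j # js) g (override_on x (z(j := t)) (insert j ?J)) \<partial>lborel) =
      indicator (box ?J x) z *\<^sub>R pdiffs js g (override_on x z ?J) -
      indicator (box ?J x) z *\<^sub>R pdiffs js g (override_on ?x0 z ?J)"
    proof (cases "z \<in> box ?J x")
      case True
      let ?y = "override_on x z ?J"
      have "z \<in> rect ?J" using True box_subset_rect[OF j(3) x] by blast
      then have y: "?y \<in> rect D" by (intro rect_override x j rectD)
      have "(\<integral>t. indicator {xmin j<..<?y j} t * pdiffs (j # js) g (?y(j := t)) \<partial>lborel) =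
          pdiffs js g ?y - pdiffs js g (?y(j := xmin j))"
        by (rule integral_pdiff[OF assms(1) Cons.prems(1,2) y])
      then show ?thesis using True j(2) by (simp add: ind[OF z] over over0)
    qed (simp add: ind[OF z])
  qed
  also have "\<dots> = (\<integral>z. indicator (box ?J x) z *\<^sub>R pdiffs js g (override_on x z ?J) \<partial>(\<Pi>\<^sub>M j\<in>?J. lborel)) -
      (\<integral>z. indicator (box ?J x) z *\<^sub>R pdiffs js g (override_on ?x0 z ?J) \<partial>(\<Pi>\<^sub>M j\<in>?J. lborel))"
    by (intro Bochner_Integration.integral_diff integrable_pdiffs_box assms(1) j x x0)
  also have "\<dots> = integ ?J (pdiffs js g) x - integ ?J (pdiffs js g) ?x0"
    by (simp add: integ_eq[OF x] integ_eq[OF x0] box0)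
  also have "\<dots> = foldr bdiff js g x - foldr bdiff js g ?x0"
    by (simp only: Cons.IH[OF j(4,3) x] Cons.IH[OF j(4,3) x0])
  also have "\<dots> = foldr bdiff (j # js) g x"
    using x by (simp add: bdiff_def)
  finally show ?case .
qed

section \<open>Conditional means with respect to the kernel\<close>

lemma kernel_prob:
  assumes "J \<subseteq> D" "z \<in> rect J"
  shows "prob_space (\<kappa> J z)" "sets (\<kappa> J z) = sets (\<Pi>\<^sub>M j\<in>D - J. borel)"
proof -
  have "z \<in> space (restrict_space (\<Pi>\<^sub>M j\<in>J. borel) (rect J))"
    using assms(2) by (auto simp: space_restrict_space space_PiM rect_def PiE_iff)
  then have "\<kappa> J z \<in> space (prob_algebra (\<Pi>\<^sub>M j\<in>D - J. borel))"
    by (rule measurable_space[OF kernel[OF assms(1)]])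
  then show "prob_space (\<kappa> J z)" "sets (\<kappa> J z) = sets (\<Pi>\<^sub>M j\<in>D - J. borel)"
    by (auto simp: space_prob_algebra)
qed

lemma merge_kernel_measurable:
  assumes "J \<subseteq> D" "z \<in> rect J"
  shows "(\<lambda>y. merge J (D - J) (z, y)) \<in> \<kappa> J z \<rightarrow>\<^sub>M (\<Pi>\<^sub>M j\<in>D. borel)"
proof -
  have "z \<in> space (\<Pi>\<^sub>M j\<in>J. borel)"
    using assms(2) by (auto simp: space_PiM rect_def PiE_iff)
  then have "(\<lambda>y. merge J (D - J) (z, y)) \<in> (\<Pi>\<^sub>M j\<in>D - J. borel) \<rightarrow>\<^sub>M (\<Pi>\<^sub>M j\<in>J \<union> (D - J). borel)"
    by (intro measurable_compose[OF _ measurable_merge] measurable_Pair1')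
  moreover have "J \<union> (D - J) = D" using assms by auto
  ultimately show ?thesis
    by (simp add: measurable_cong_sets[OF kernel_prob(2)[OF assms] refl])
qed

lemma cond_mean_integrable:
  assumes "J \<subseteq> D" "z \<in> rect J" "\<phi> \<in> borel_measurable (\<Pi>\<^sub>M j\<in>D. borel)" "\<And>x. \<bar>\<phi> x\<bar> \<le> (B::real)"
  shows "integrable (\<kappa> J z) (\<lambda>y. \<phi> (merge J (D - J) (z, y)))"
proof -
  interpret K: prob_space "\<kappa> J z" by (rule kernel_prob[OF assms(1,2)])
  show ?thesis
    using assms(4) by (intro K.integrable_const_bound[where B = B]
        measurable_compose[OF merge_kernel_measurable[OF assms(1,2)] assms(3)]) auto
qed

lemma cond_mean_bound:
  assumes "J \<subseteq> D" "z \<in> rect J" "\<phi> \<in> borel_measurable (\<Pi>\<^sub>M j\<in>D. borel)" "\<And>x. \<bar>\<phi> x\<bar> \<le> (B::real)"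
  shows "\<bar>cond_mean J \<phi> z\<bar> \<le> B"
proof -
  interpret K: prob_space "\<kappa> J z" by (rule kernel_prob[OF assms(1,2)])
  have int: "integrable (\<kappa> J z) (\<lambda>y. \<phi> (merge J (D - J) (z, y)))"
    by (rule cond_mean_integrable[OF assms])
  have "\<phi> x \<le> B" "- B \<le> \<phi> x" for x using assms(4)[of x] by auto
  then have "cond_mean J \<phi> z \<le> B" "- B \<le> cond_mean J \<phi> z"
    unfolding cond_mean_def using int by (auto intro!: K.integral_le_const K.integral_ge_const)
  then show ?thesis by auto
qed

text \<open>\<open>cond_mean J \<phi> z\<close> integrates \<phi> against the image of
  \<open>\<kappa> J z\<close> under \<open>merge\<close>, and this image depends measurably on
  \<open>z\<close>. The kernel is a measurable map on \<open>rect J\<close> only, hence the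
  indicator; \<open>lborel\<close> and \<open>borel\<close> have the same measurable sets.\<close>

lemma cond_mean_measurable:
  assumes "J \<subseteq> D" "\<phi> \<in> borel_measurable (\<Pi>\<^sub>M j\<in>D. borel)"
  shows "(\<lambda>z. indicator (rect J) z *\<^sub>R cond_mean J \<phi> z) \<in> borel_measurable (\<Pi>\<^sub>M j\<in>J. lborel)"
proof -
  let ?R = "restrict_space (\<Pi>\<^sub>M j\<in>J. (borel :: real measure)) (rect J)"
  have fin: "finite J" using assms(1) finite_subset by blast
  have eq: "J \<union> (D - J) = D" using assms by auto
  have "(\<lambda>x. x) \<in> ?R \<rightarrow>\<^sub>M (\<Pi>\<^sub>M j\<in>J. borel)"
    by (rule measurable_restrict_space1) simp
  then have "(\<lambda>p. (fst p, snd p)) \<in> (?R \<Otimes>\<^sub>M (\<Pi>\<^sub>M j\<in>D - J. (borel :: real measure)))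
      \<rightarrow>\<^sub>M ((\<Pi>\<^sub>M j\<in>J. borel) \<Otimes>\<^sub>M (\<Pi>\<^sub>M j\<in>D - J. borel))"
    by (intro measurable_Pair measurable_snd measurable_compose[OF measurable_fst])
  from measurable_compose[OF this measurable_merge]
  have "merge J (D - J) \<in> (?R \<Otimes>\<^sub>M (\<Pi>\<^sub>M j\<in>D - J. borel)) \<rightarrow>\<^sub>M (\<Pi>\<^sub>M j\<in>J \<union> (D - J). (borel :: real measure))"
    by simp
  then have "(\<lambda>z. distr (\<kappa> J z) (\<Pi>\<^sub>M j\<in>D. borel) (\<lambda>y. merge J (D - J) (z, y))) \<in> ?R \<rightarrow>\<^sub>M subprob_algebra (\<Pi>\<^sub>M j\<in>D. borel)"
    unfolding eq by (intro measurable_distr2[where M = "\<Pi>\<^sub>M j\<in>D - J. borel"] measurable_prob_algebraD kernel assms) simp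
  from measurable_compose[OF this integral_measurable_subprob_algebra[OF assms(2)]]
  have "(\<lambda>z. \<integral>x. \<phi> x \<partial>distr (\<kappa> J z) (\<Pi>\<^sub>M j\<in>D. borel) (\<lambda>y. merge J (D - J) (z, y))) \<in> borel_measurable ?R" .
  also have "?this \<longleftrightarrow> cond_mean J \<phi> \<in> borel_measurable ?R"
  proof (rule measurable_cong)
    fix z assume "z \<in> space ?R"
    then have "z \<in> rect J" by (simp add: space_restrict_space)
    then show "(\<integral>x. \<phi> x \<partial>distr (\<kappa> J z) (\<Pi>\<^sub>M j\<in>D. borel) (\<lambda>y. merge J (D - J) (z, y))) = cond_mean J \<phi> z"
      unfolding cond_mean_def by (intro integral_distr merge_kernel_measurable assms)
  qed
  finally have "(\<lambda>z. indicator (rect J) z *\<^sub>R cond_mean J \<phi> z) \<in> borel_measurable (\<Pi>\<^sub>M j\<in>J. borel)"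
    using rect_borel[OF fin] by (subst (asm) borel_measurable_restrict_space_iff) auto
  also have "?this \<longleftrightarrow> ?thesis"
    by (intro arg_cong2[where f = "(\<in>)"] measurable_cong_sets sets_PiM_cong refl) simp_all
  finally show ?thesis .
qed

end

section \<open>Basic properties of the ALE integral and of marginal means\<close>

context feature_model
begin

lemma L_ALE_eq:
  "x \<in> rect D \<Longrightarrow> L_ALE J g x =
    (\<integral>z. indicator (box J x) z *\<^sub>R cond_mean J (mixed_diff J g) z \<partial>(\<Pi>\<^sub>M j\<in>J. lborel))"
  by (simp add: L_ALE_def set_lebesgue_integral_def box_def)

lemma L_ALE_out: "x \<notin> rect D \<Longrightarrow> L_ALE J g x = 0"
  by (simp add: L_ALE_def)

lemma box_cong: "(\<And>j. j \<in> J \<Longrightarrow> x j = y j) \<Longrightarrow> box J x = box J y"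
  unfolding box_def by (intro PiE_cong) simp

lemma L_ALE_depends_on: "depends_on J (L_ALE J g)"
proof (rule depends_onI)
  fix x y assume xy: "x \<in> rect D" "y \<in> rect D" "\<And>j. j \<in> J \<Longrightarrow> x j = y j"
  then have "box J x = box J y" by (intro box_cong)
  then show "L_ALE J g x = L_ALE J g y"
    using xy(1,2) by (simp only: L_ALE_eq)
qed

lemma marg_mean_eq:
  "x \<in> rect D \<Longrightarrow> marg_mean J g x = expectation (\<lambda>\<omega>. g (override_on (X \<omega>) x J))"
  by (simp add: marg_mean_def)

lemma marg_mean_depends_on: "depends_on J (marg_mean J g)"
proof (rule depends_onI)
  fix x y assume xy: "x \<in> rect D" "y \<in> rect D" "\<And>j. j \<in> J \<Longrightarrow> x j = y j"
  then have "override_on f x J = override_on f y J" for f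
    by (auto simp: override_on_def)
  then show "marg_mean J g x = marg_mean J g y"
    using xy by (simp add: marg_mean_eq)
qed

text \<open>The integral reaches only points of \<open>box J x\<close>, and these lie in
  \<open>rect J\<close>.\<close>

lemma L_ALE_eq_cong:
  assumes "J \<subseteq> D" "\<And>z. z \<in> rect J \<Longrightarrow> cond_mean J (mixed_diff J g) z = cond_mean J (mixed_diff J h) z"
  shows "L_ALE J g = L_ALE J h"
proof
  fix x show "L_ALE J g x = L_ALE J h x"
  proof (cases "x \<in> rect D")
    case True
    have "indicator (box J x) z *\<^sub>R cond_mean J (mixed_diff J g) z =
        indicator (box J x) z *\<^sub>R cond_mean J (mixed_diff J h) z" for z
      using assms(2)[of z] box_subset_rect[OF assms(1) True] by (cases "z \<in> box J x") auto
    then show ?thesis by (simp only: L_ALE_eq[OF True])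
  qed (simp add: L_ALE_out)
qed

lemma H_ALE_empty: "H_ALE {} g = mean g"
  by (simp add: H_ALE.simps)

lemma H_ALE_nonempty:
  "J \<noteq> {} \<Longrightarrow> J \<subseteq> D \<Longrightarrow>
    H_ALE J g = (\<lambda>x. L_ALE J g x - (\<Sum>J' | J' \<subset> J. H_ALE J' (L_ALE J g) x))"
  using finite_subset[of J D] by (subst H_ALE.simps) simp

end

context ale_setting
begin

lemma mixed_diff_measurable: "g \<in> V \<Longrightarrow> J \<subseteq> D \<Longrightarrow> mixed_diff J g \<in> borel_measurable (\<Pi>\<^sub>M j\<in>D. borel)"
  using mixed_diff_sorted[of J "mixed_diff J g \<in> borel_measurable (\<Pi>\<^sub>M j\<in>D. borel)"] pdiffs_measurable[of g]
  by simp

lemma mixed_diff_bounded: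
  assumes "g \<in> V" "J \<subseteq> D"
  obtains B where "\<And>x. \<bar>mixed_diff J g x\<bar> \<le> B"
proof -
  obtain js where js: "distinct js" "set js = J" "\<And>g. mixed_diff J g = pdiffs js g"
    using mixed_diff_sorted[OF assms(2)] by blast
  with assms have "set js \<subseteq> D" by simp
  from pdiffs_bounded[OF assms(1) js(1) this] show ?thesis
    using that js(3) by auto
qed

lemma mixed_diff_lincomb:
  assumes "g \<in> V" "h \<in> V" "J \<subseteq> D"
  shows "mixed_diff J (\<lambda>x. a * g x + b * h x) = (\<lambda>x. a * mixed_diff J g x + b * mixed_diff J h x)"
proof -
  obtain js where "distinct js" "set js = J" "\<And>g. mixed_diff J g = pdiffs js g"
    using mixed_diff_sorted[OF assms(3)] by blast
  then show ?thesis using assms by (simp add: pdiffs_lincomb)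
qed

text \<open>Integration over \<open>\<kappa> J z\<close> varies only coordinates outside
  \<open>J\<close>, so the integrand is almost surely constant; almost surely, because dependence on
  \<open>J\<close> is known inside \<open>rect D\<close> alone. The point \<open>x\<close> supplies
  admissible coordinates outside \<open>J\<close>.\<close>

lemma cond_mean_depends_on:
  assumes "J \<subseteq> D" "depends_on J \<phi>" "\<phi> \<in> borel_measurable (\<Pi>\<^sub>M j\<in>D. borel)" "x \<in> rect D" "z \<in> rect J"
  shows "cond_mean J \<phi> z = \<phi> (override_on x z J)"
proof -
  interpret K: prob_space "\<kappa> J z" by (rule kernel_prob[OF assms(1,5)])
  have x: "override_on x z J \<in> rect D"
    by (intro rect_override[OF assms(4,1)] rectD[OF assms(5)])
  have "AE y in \<kappa> J z. \<phi> (merge J (D - J) (z, y)) = \<phi> (override_on x z J)"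
    using kernel_rect[OF assms(1,5)]
  proof eventually_elim
    case (elim y)
    show ?case
      by (rule depends_onD[OF assms(2) rect_merge[OF assms(1,5) elim] x]) (simp add: merge_def)
  qed
  then have "cond_mean J \<phi> z = (\<integral>y. \<phi> (override_on x z J) \<partial>\<kappa> J z)"
    unfolding cond_mean_def
    by (intro integral_cong_AE measurable_compose[OF merge_kernel_measurable[OF assms(1,5)] assms(3)]) auto
  then show ?thesis by (simp add: K.prob_space)
qed

text \<open>The mixed derivative inherits dependence on \<open>J\<close>, so its conditional mean is
  evaluation, and \<open>integ_pdiffs\<close> turns the integral into iterated boundary differences.
  The list stays abstract, as only its set matters later.\<close>

lemma L_ALE_depends_on_eq:
  assumes "J \<subseteq> D" "g \<in> V" "depends_on J g"
  obtains js where "set js = J" "\<And>x. x \<in> rect D \<Longrightarrow> L_ALE J g x = foldr bdiff js g x"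
proof -
  obtain js where js: "distinct js" "set js = J" "\<And>g. mixed_diff J g = pdiffs js g"
    using mixed_diff_sorted[OF assms(1)] by blast
  have "L_ALE J g x = foldr bdiff js g x" if x: "x \<in> rect D" for x
  proof -
    have "indicator (box J x) z *\<^sub>R cond_mean J (mixed_diff J g) z =
        indicator (box J x) z *\<^sub>R pdiffs js g (override_on x z J)" for z
    proof (cases "z \<in> box J x")
      case True
      then have "z \<in> rect J" using box_subset_rect[OF assms(1) x] by blast
      then show ?thesis
        using cond_mean_depends_on[OF assms(1) mixed_diff_depends_on[OF assms(3,1)]
            mixed_diff_measurable[OF assms(2,1)] x] js(3) by simp
    qed simp
    then have "L_ALE J g x = integ (set js) (pdiffs js g) x"
      by (simp only: L_ALE_eq[OF x] integ_eq[OF x] js(2))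
    also have "\<dots> = foldr bdiff js g x"
      using assms js x by (intro integ_pdiffs) auto
    finally show ?thesis .
  qed
  then show ?thesis using js(2) that by blast
qed

lemma L_ALE_integrable:
  assumes "g \<in> V" "J \<subseteq> D" "x \<in> rect D"
  shows "integrable (\<Pi>\<^sub>M j\<in>J. lborel) (\<lambda>z. indicator (box J x) z *\<^sub>R cond_mean J (mixed_diff J g) z)"
proof -
  obtain B where B: "\<And>x. \<bar>mixed_diff J g x\<bar> \<le> B"
    using mixed_diff_bounded[OF assms(1,2)] by blast
  \<comment> \<open>Measurability of the conditional mean is known only after multiplication by the
    indicator of \<open>rect J\<close>. Since \<open>box J x\<close> lies inside
    \<open>rect J\<close>, this indicator can be inserted here and removed again below.\<close>
  have "integrable (\<Pi>\<^sub>M j\<in>J. lborel)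
      (\<lambda>z. indicator (box J x) z *\<^sub>R (indicator (rect J) z *\<^sub>R cond_mean J (mixed_diff J g) z))"
  proof (rule integrable_on_box)
    show "finite J" using assms(2) finite_subset by blast
    show "(\<lambda>z. indicator (rect J) z *\<^sub>R cond_mean J (mixed_diff J g) z) \<in> borel_measurable (\<Pi>\<^sub>M j\<in>J. lborel)"
      by (intro cond_mean_measurable mixed_diff_measurable assms)
    fix z assume "z \<in> box J x"
    then have "z \<in> rect J" using box_subset_rect[OF assms(2,3)] by blast
    then show "\<bar>indicator (rect J) z *\<^sub>R cond_mean J (mixed_diff J g) z\<bar> \<le> B"
      using cond_mean_bound[OF assms(2) _ mixed_diff_measurable[OF assms(1,2)] B] by simp
  qed
  also have "(\<lambda>z. indicator (box J x) z *\<^sub>R (indicator (rect J) z *\<^sub>R cond_mean J (mixed_diff J g) z)) =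
      (\<lambda>z. indicator (box J x) z *\<^sub>R cond_mean J (mixed_diff J g) z)"
    using box_subset_rect[OF assms(2,3)] by (auto simp: indicator_def fun_eq_iff)
  finally show ?thesis .
qed

text \<open>Linearity passes through the mixed derivative, the conditional mean and the integral
  over the box; boundedness of mixed derivatives gives the integrability for the last two.\<close>

lemma L_ALE_lincomb:
  assumes "g \<in> V" "h \<in> V" "J \<subseteq> D"
  shows "L_ALE J (\<lambda>x. a * g x + b * h x) = (\<lambda>x. a * L_ALE J g x + b * L_ALE J h x)"
proof
  fix x show "L_ALE J (\<lambda>x. a * g x + b * h x) x = a * L_ALE J g x + b * L_ALE J h x"
  proof (cases "x \<in> rect D")
    case True
    have *: "indicator (box J x) z *\<^sub>R cond_mean J (mixed_diff J (\<lambda>x. a * g x + b * h x)) z =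
        a * (indicator (box J x) z *\<^sub>R cond_mean J (mixed_diff J g) z) +
        b * (indicator (box J x) z *\<^sub>R cond_mean J (mixed_diff J h) z)" for z
    proof (cases "z \<in> box J x")
      case z: True
      then have z': "z \<in> rect J" using box_subset_rect[OF assms(3) True] by blast
      have int: "integrable (\<kappa> J z) (\<lambda>y. mixed_diff J f (merge J (D - J) (z, y)))" if f: "f \<in> V" for f
      proof -
        obtain B where "\<And>x. \<bar>mixed_diff J f x\<bar> \<le> B"
          using mixed_diff_bounded[OF f assms(3)] by blast
        then show ?thesis
          by (intro cond_mean_integrable[where B = B] mixed_diff_measurable f assms z')
      qed
      show ?thesis using z int[OF assms(1)] int[OF assms(2)]
        by (simp add: mixed_diff_lincomb[OF assms] cond_mean_def)
    qed simp
    show ?thesis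
      unfolding L_ALE_eq[OF True] *
      using L_ALE_integrable[OF assms(1,3) True] L_ALE_integrable[OF assms(2,3) True] by simp
  qed (simp add: L_ALE_out)
qed

lemma L_ALE_eq_0:
  assumes "g \<in> V" "J \<subseteq> D" "\<And>x. x \<in> rect D \<Longrightarrow> mixed_diff J g x = 0"
  shows "L_ALE J g = (\<lambda>_. 0)"
proof -
  have "mixed_diff J g = (\<lambda>_. 0)"
  proof
    fix x show "mixed_diff J g x = 0"
      using assms pdiffs_out[OF assms(1), of x] by (cases "x \<in> rect D") (auto simp: mixed_diff_def)
  qed
  then show ?thesis
    by (auto simp: L_ALE_def cond_mean_def on_rect_def set_lebesgue_integral_def)
qed

section \<open>The algebra of the ALE operators\<close>

lemma V_lincomb: "g \<in> V \<Longrightarrow> h \<in> V \<Longrightarrow> (\<lambda>x. a * g x + b * h x) \<in> V"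
  by (intro V_add V_scale)

lemma V_diff: "g \<in> V \<Longrightarrow> h \<in> V \<Longrightarrow> (\<lambda>x. g x - h x) \<in> V"
  using V_lincomb[of g h 1 "-1"] by simp

lemma V_zero: "(\<lambda>_. 0) \<in> V"
  using V_const[of 0] by (simp add: on_rect_def)

lemma V_sum: "finite I \<Longrightarrow> (\<And>i. i \<in> I \<Longrightarrow> f i \<in> V) \<Longrightarrow> (\<lambda>x. \<Sum>i\<in>I. f i x) \<in> V"
  by (induction I rule: finite_induct) (simp_all add: V_zero V_add)

lemma V_eqI:
  assumes "g \<in> V" "h \<in> V" "\<And>x. x \<in> rect D \<Longrightarrow> g x = h x"
  shows "g = h"
proof
  fix x show "g x = h x"
    using assms(3) V_outside[OF assms(1)] V_outside[OF assms(2)] by metis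
qed

lemma V_on_iff: "g \<in> V_on J \<longleftrightarrow> g \<in> V \<and> depends_on J g"
  by (simp add: V_on_def depends_on_def)

lemma V_on_lincomb:
  assumes "g \<in> V_on J" "h \<in> V_on J"
  shows "(\<lambda>x. a * g x + b * h x) \<in> V_on J"
proof -
  have "depends_on J (\<lambda>x. a * g x + b * h x)"
  proof (rule depends_onI)
    fix x y assume "x \<in> rect D" "y \<in> rect D" "\<And>j. j \<in> J \<Longrightarrow> x j = y j"
    then have "g x = g y" "h x = h y"
      using assms unfolding V_on_iff by (blast intro: depends_onD)+
    then show "a * g x + b * h x = a * g y + b * h y" by simp
  qed
  then show ?thesis using assms by (simp add: V_on_iff V_lincomb)
qed

lemma V_on_mono: "g \<in> V_on J \<Longrightarrow> J \<subseteq> K \<Longrightarrow> g \<in> V_on K"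
  unfolding V_on_iff using depends_on_mono by blast

lemma V_on_sum: "finite I \<Longrightarrow> (\<And>i. i \<in> I \<Longrightarrow> f i \<in> V_on J) \<Longrightarrow> (\<lambda>x. \<Sum>i\<in>I. f i x) \<in> V_on J"
proof (induction I rule: finite_induct)
  case empty
  show ?case by (simp add: V_on_iff V_zero depends_on_def)
next
  case (insert i I)
  then have "f i \<in> V_on J" "(\<lambda>x. \<Sum>i\<in>I. f i x) \<in> V_on J" by simp_all
  from V_on_lincomb[OF this, of 1 1] insert.hyps show ?case by simp
qed

lemma V_subst_xmin:
  assumes "g \<in> V_on J" "J \<subseteq> D" "j \<in> J"
  shows "on_rect (\<lambda>x. g (x(j := xmin j))) \<in> V_on (J - {j})"
proof -
  have j: "j \<in> D" using assms by auto
  then have t: "xmin j \<in> \<X> j" using xmin_less_xmax[OF j] by auto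
  \<comment> \<open>Closure under substitution takes an extensional point of
    \<open>rect {j}\<close>, hence the restriction of \<open>xmin\<close>.\<close>
  then have "restrict xmin {j} \<in> rect {j}" by (simp add: rect_def)
  then have "on_rect (\<lambda>x. g (override_on x (restrict xmin {j}) {j})) \<in> V"
    by (rule V_subst[rotated 2]) (use assms(1) j in \<open>auto simp: V_on_iff\<close>)
  also have "(\<lambda>x. g (override_on x (restrict xmin {j}) {j})) = (\<lambda>x. g (x(j := xmin j)))"
    by (simp add: override_on_insert[of _ _ j "{}"])
  finally have "on_rect (\<lambda>x. g (x(j := xmin j))) \<in> V" .
  moreover have "depends_on (J - {j}) (on_rect (\<lambda>x. g (x(j := xmin j))))"
  proof (rule depends_onI)
    fix x y assume xy: "x \<in> rect D" "y \<in> rect D" "\<And>i. i \<in> J - {j} \<Longrightarrow> x i = y i"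
    have "g (x(j := xmin j)) = g (y(j := xmin j))"
      by (rule depends_onD[of J g]) (use assms(1) xy rect_upd[OF _ j t] in \<open>auto simp: V_on_iff\<close>)
    then show "on_rect (\<lambda>x. g (x(j := xmin j))) x = on_rect (\<lambda>x. g (x(j := xmin j))) y"
      using xy by simp
  qed
  ultimately show ?thesis by (simp add: V_on_iff)
qed

lemma bdiff_eq: "g \<in> V \<Longrightarrow> bdiff j g = (\<lambda>x. g x - on_rect (\<lambda>x. g (x(j := xmin j))) x)"
  by (auto simp: bdiff_def on_rect_def V_outside)

lemma mean_lincomb:
  assumes "g \<in> V" "h \<in> V"
  shows "mean (\<lambda>x. a * g x + b * h x) = (\<lambda>x. a * mean g x + b * mean h x)"
proof -
  have int: "integrable M (\<lambda>\<omega>. f (X \<omega>))" if f: "f \<in> V" for f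
  proof -
    obtain B where "\<And>x. \<bar>f x\<bar> \<le> B"
      using V_bounded[OF f] by (auto simp: bounded_iff)
    then show ?thesis
      by (intro integrable_const_bound[where B = B] measurable_compose[OF random_vector V_measurable] f) auto
  qed
  show ?thesis using int[OF assms(1)] int[OF assms(2)] by (auto simp: mean_def on_rect_def)
qed

lemma L_ALE_V_on: "g \<in> V \<Longrightarrow> J \<subseteq> D \<Longrightarrow> J \<noteq> {} \<Longrightarrow> L_ALE J g \<in> V_on J"
  by (simp add: V_on_iff V_L_ALE L_ALE_depends_on)

lemma finite_psubsets: "J \<subseteq> D \<Longrightarrow> finite {J'. J' \<subset> J}" "J \<subseteq> D \<Longrightarrow> finite {J'. J' \<subseteq> J}"
  using finite_subset[of J D] by (auto intro: finite_subset[of _ "Pow J"])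

lemma H_ALE_V_on:
  assumes "J \<subseteq> D" "g \<in> V"
  shows "H_ALE J g \<in> V_on J"
  using finite_subset[OF assms(1) finite_atLeastAtMost] assms
proof (induction J arbitrary: g rule: finite_psubset_induct)
  case (psubset J)
  show ?case
  proof (cases "J = {}")
    case True
    then show ?thesis by (simp add: H_ALE_empty V_on_iff depends_on_def mean_def V_const)
  next
    case False
    have L: "L_ALE J g \<in> V_on J" using L_ALE_V_on psubset.prems False by blast
    have "H_ALE J' (L_ALE J g) \<in> V_on J" if "J' \<subset> J" for J'
      using that L psubset.IH[OF that] psubset.prems(1) V_on_mono[of _ J' J] by (auto simp: V_on_iff)
    then have "(\<lambda>x. \<Sum>J' | J' \<subset> J. H_ALE J' (L_ALE J g) x) \<in> V_on J"
      by (intro V_on_sum finite_psubsets psubset.prems) auto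
    from V_on_lincomb[OF L this, of 1 "-1"] show ?thesis
      using psubset.prems False by (simp add: H_ALE_nonempty)
  qed
qed

lemma H_ALE_V: "J \<subseteq> D \<Longrightarrow> g \<in> V \<Longrightarrow> H_ALE J g \<in> V"
  using H_ALE_V_on by (simp add: V_on_iff)

text \<open>The recursion evaluates the lower operators at \<open>L_ALE J g\<close>, so the
  induction hypothesis must hold for all functions of \<open>V\<close>.\<close>

lemma H_ALE_lincomb:
  assumes "J \<subseteq> D" "g \<in> V" "h \<in> V"
  shows "H_ALE J (\<lambda>x. a * g x + b * h x) = (\<lambda>x. a * H_ALE J g x + b * H_ALE J h x)"
  using finite_subset[OF assms(1) finite_atLeastAtMost] assms
proof (induction J arbitrary: g h rule: finite_psubset_induct)
  case (psubset J)
  show ?case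
  proof (cases "J = {}")
    case True
    then show ?thesis using psubset.prems by (simp add: H_ALE_empty mean_lincomb)
  next
    case False
    have "H_ALE J' (\<lambda>x. a * L_ALE J g x + b * L_ALE J h x) x =
        a * H_ALE J' (L_ALE J g) x + b * H_ALE J' (L_ALE J h) x" if "J' \<subset> J" for J' x
      using psubset.IH[OF that] that psubset.prems False by (simp add: V_L_ALE psubset_imp_subset)
    then show ?thesis using psubset.prems False
      by (simp add: H_ALE_nonempty L_ALE_lincomb sum.distrib sum_distrib_left algebra_simps)
  qed
qed

lemma H_ALE_zero: "J \<subseteq> D \<Longrightarrow> H_ALE J (\<lambda>_. 0) = (\<lambda>_. 0)"
  using H_ALE_lincomb[of J "\<lambda>_. 0" "\<lambda>_. 0" 0 0] V_zero by simp

lemma H_ALE_diff: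
  "J \<subseteq> D \<Longrightarrow> g \<in> V \<Longrightarrow> h \<in> V \<Longrightarrow> H_ALE J (\<lambda>x. g x - h x) = (\<lambda>x. H_ALE J g x - H_ALE J h x)"
  using H_ALE_lincomb[of J g h 1 "-1"] by simp

lemma H_ALE_add:
  "J \<subseteq> D \<Longrightarrow> g \<in> V \<Longrightarrow> h \<in> V \<Longrightarrow> H_ALE J (\<lambda>x. g x + h x) = (\<lambda>x. H_ALE J g x + H_ALE J h x)"
  using H_ALE_lincomb[of J g h 1 1] by simp

lemma H_ALE_sum:
  assumes "J \<subseteq> D" "finite I" "\<And>i. i \<in> I \<Longrightarrow> f i \<in> V"
  shows "H_ALE J (\<lambda>x. \<Sum>i\<in>I. f i x) = (\<lambda>x. \<Sum>i\<in>I. H_ALE J (f i) x)"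
  using assms(2,3)
  by (induction I rule: finite_induct) (simp_all add: H_ALE_zero[OF assms(1)] H_ALE_add[OF assms(1)] V_sum)

section \<open>Relevance, lean decomposability and composition of the operators\<close>

lemma H_ALE_relevant:
  assumes "J \<subseteq> D" "g \<in> V" "\<And>x. x \<in> rect D \<Longrightarrow> mixed_diff J g x = 0"
  shows "H_ALE J g = (\<lambda>_. 0)"
proof (cases "J = {}")
  case True
  \<comment> \<open>With no variable to differentiate, the hypothesis says that \<open>g\<close>
    itself vanishes on \<open>rect D\<close>.\<close>
  then have "g = (\<lambda>_. 0)"
    using assms by (intro V_eqI V_zero) (auto simp: mixed_diff_def)
  then show ?thesis using assms(1) H_ALE_zero by blast
next
  case False
  have "H_ALE J' (\<lambda>_. 0) x = 0" if "J' \<subset> J" for J' x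
    using that assms(1) H_ALE_zero[of J'] by (simp add: psubset_imp_subset)
  then show ?thesis
    using L_ALE_eq_0[OF assms(2,1)] assms(3) by (simp add: H_ALE_nonempty[OF False assms(1)])
qed

text \<open>Some variable of \<open>J\<close> is missing from \<open>g\<close>, so the mixed
  derivative over \<open>J\<close> is 0 and relevance applies. This cuts sums over many index sets
  down to the subsets of \<open>K\<close>.\<close>

lemma H_ALE_V_on_eq_0:
  assumes "J \<subseteq> D" "g \<in> V_on K" "\<not> J \<subseteq> K"
  shows "H_ALE J g = (\<lambda>_. 0)"
  using assms mixed_diff_eq_0[of K g J] by (intro H_ALE_relevant) (auto simp: V_on_iff)

lemma mean_V_on_empty:
  assumes "g \<in> V_on {}"
  shows "mean g = g"
proof (rule V_eqI)
  show "mean g \<in> V" by (simp add: mean_def V_const)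
  show "g \<in> V" using assms by (simp add: V_on_iff)
  fix x assume x: "x \<in> rect D"
  have "AE \<omega> in M. g (X \<omega>) = g x"
    using X_in_rect
  proof eventually_elim
    case (elim \<omega>)
    show ?case by (rule depends_onD[of "{}", OF _ elim x]) (use assms in \<open>simp_all add: V_on_iff\<close>)
  qed
  then have "expectation (\<lambda>\<omega>. g (X \<omega>)) = expectation (\<lambda>\<omega>. g x)"
    using measurable_compose[OF random_vector V_measurable[OF \<open>g \<in> V\<close>]] by (intro integral_cong_AE) auto
  then show "mean g x = g x"
    using x by (simp add: mean_def prob_space)
qed

text \<open>By the recursion, the operators for all subsets of \<open>J\<close> sum at
  \<open>g\<close> to \<open>L_ALE J g\<close> plus the operators for proper subsets at
  \<open>g - L_ALE J g\<close>. The latter function is a sum of functions of fewer variables, which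
  the lower operators reproduce by the induction hypothesis, so the total is
  \<open>g\<close>.\<close>

lemma H_ALE_lean:
  assumes "J \<subseteq> D" "g \<in> V_on J"
  shows "(\<Sum>J' | J' \<subseteq> J. H_ALE J' g x) = g x"
  using finite_subset[OF assms(1) finite_atLeastAtMost] assms
proof (induction J arbitrary: g x rule: finite_psubset_induct)
  case (psubset J)
  note J = psubset.prems(1)
  have g: "g \<in> V" "depends_on J g" using psubset.prems by (auto simp: V_on_iff)
  show ?case
  proof (cases "J = {}")
    case True
    then show ?thesis using psubset.prems by (simp add: H_ALE_empty mean_V_on_empty)
  next
    case False
    \<comment> \<open>A function of fewer variables is annihilated by the operators for sets not
      inside \<open>K\<close>, which reduces the sum to the induction hypothesis for
      \<open>K\<close>.\<close>
    have lower: "(\<Sum>J' | J' \<subset> J. H_ALE J' r x) = r x" if "r \<in> V_on K" "K \<subset> J" for r K x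
    proof -
      have "(\<Sum>J' | J' \<subset> J. H_ALE J' r x) = (\<Sum>J' | J' \<subseteq> K. H_ALE J' r x)"
      proof (intro sum.mono_neutral_right ballI finite_psubsets J)
        fix J' assume "J' \<in> {J'. J' \<subset> J} - {J'. J' \<subseteq> K}"
        then show "H_ALE J' r x = 0"
          using H_ALE_V_on_eq_0[of J' r K] that J by auto
      qed (use that in auto)
      also have "\<dots> = r x" using psubset.IH[OF that(2)] that J by auto
      finally show ?thesis .
    qed
    \<comment> \<open>Each factor of the iterated difference subtracts a function that misses one variable of \<open>J\<close>.\<close>
    have telescope: "foldr bdiff js g \<in> V_on J \<and>
        (\<forall>x. (\<Sum>J' | J' \<subset> J. H_ALE J' (\<lambda>x. g x - foldr bdiff js g x) x) = g x - foldr bdiff js g x)"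
      if "set js \<subseteq> J" for js
      using that
    proof (induction js)
      case Nil
      have "H_ALE J' (\<lambda>x. 0) x = 0" if "J' \<subset> J" for J' x
        using that J H_ALE_zero[of J'] by (simp add: psubset_imp_subset)
      then show ?case using psubset.prems by simp
    next
      case (Cons j js)
      define f where "f = foldr bdiff js g"
      define r where "r = on_rect (\<lambda>x. f (x(j := xmin j)))"
      have f: "f \<in> V_on J" "\<And>x. (\<Sum>J' | J' \<subset> J. H_ALE J' (\<lambda>x. g x - f x) x) = g x - f x"
        using Cons by (auto simp: f_def)
      have r: "r \<in> V_on (J - {j})" "J - {j} \<subset> J"
        unfolding r_def using V_subst_xmin[OF f(1) J] Cons.prems by auto
      have rJ: "r \<in> V_on J" using r V_on_mono by blast
      have eq: "foldr bdiff (j # js) g = (\<lambda>x. f x - r x)"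
        using f(1) by (simp add: f_def[symmetric] r_def bdiff_eq V_on_iff)
      have "(\<Sum>J' | J' \<subset> J. H_ALE J' (\<lambda>x. g x - (f x - r x)) x) = g x - (f x - r x)" for x
      proof -
        have "H_ALE J' (\<lambda>x. g x - (f x - r x)) x = H_ALE J' (\<lambda>x. g x - f x) x + H_ALE J' r x"
          if "J' \<subset> J" for J'
          using H_ALE_add[of J' "\<lambda>x. g x - f x" r] V_diff[of g f] that J g f(1) rJ
          by (auto simp: V_on_iff algebra_simps)
        then show ?thesis
          using f(2) lower[OF r] by (simp add: sum.distrib)
      qed
      then show ?case
        unfolding eq using V_on_lincomb[OF f(1) rJ, of 1 "-1"] by simp
    qed
    obtain js where js: "set js = J" "\<And>x. x \<in> rect D \<Longrightarrow> L_ALE J g x = foldr bdiff js g x"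
      using L_ALE_depends_on_eq[OF J g] by blast
    have L: "L_ALE J g \<in> V" using V_L_ALE g J False by blast
    have "L_ALE J g = foldr bdiff js g"
      using telescope[of js] js L by (intro V_eqI) (auto simp: V_on_iff)
    then have sum: "(\<Sum>J' | J' \<subset> J. H_ALE J' (\<lambda>x. g x - L_ALE J g x) x) = g x - L_ALE J g x"
      using telescope[of js] js(1) by simp
    have "H_ALE J' (\<lambda>x. g x - L_ALE J g x) x = H_ALE J' g x - H_ALE J' (L_ALE J g) x" if "J' \<subset> J" for J'
      using that J H_ALE_diff[of J' g "L_ALE J g"] g L by auto
    then have sum': "(\<Sum>J' | J' \<subset> J. H_ALE J' g x) - (\<Sum>J' | J' \<subset> J. H_ALE J' (L_ALE J g) x) = g x - L_ALE J g x"
      using sum by (simp add: sum_subtractf)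
    \<comment> \<open>The top term \<open>H_ALE J g\<close> is \<open>L_ALE J g\<close> minus the
      second sum of \<open>sum'\<close>; adding it cancels both and leaves \<open>g\<close>.\<close>
    have "{J'. J' \<subseteq> J} = insert J {J'. J' \<subset> J}" by auto
    then show ?thesis
      using sum' finite_psubsets(1)[OF J] False J by (simp add: H_ALE_nonempty)
  qed
qed

lemma H_ALE_L_ALE:
  assumes "J \<subseteq> D" "J \<noteq> {}" "g \<in> V"
  shows "H_ALE J (L_ALE J g) = H_ALE J g"
proof
  fix x
  have "{J'. J' \<subseteq> J} = insert J {J'. J' \<subset> J}" by auto
  then show "H_ALE J (L_ALE J g) x = H_ALE J g x"
    using H_ALE_lean[OF assms(1) L_ALE_V_on[OF assms(3,1,2)], of x] finite_psubsets(1)[OF assms(1)]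
    by (simp add: H_ALE_nonempty[OF assms(2,1), of g])
qed

text \<open>If \<open>J'\<close> is not inside \<open>J\<close>, then \<open>H_ALE J g\<close>
  misses a variable of \<open>J'\<close>. Otherwise \<open>H_ALE J'\<close> is applied to the
  recursion, where by induction only the summand for \<open>J'\<close> can survive. It cancels the
  leading term when \<open>J'\<close> is proper and is absent when \<open>J' = J\<close>, where
  \<open>H_ALE_L_ALE\<close> identifies the result.\<close>

lemma H_ALE_comp:
  assumes "J \<subseteq> D" "J' \<subseteq> D" "g \<in> V"
  shows "H_ALE J' (H_ALE J g) = (if J' = J then H_ALE J g else (\<lambda>_. 0))"
  using finite_subset[OF assms(1) finite_atLeastAtMost] assms
proof (induction J arbitrary: J' g rule: finite_psubset_induct)
  case (psubset J)
  note J = psubset.prems(1) and J' = psubset.prems(2) and g = psubset.prems(3)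
  show ?case
  proof (cases "J' \<subseteq> J")
    case False
    then show ?thesis using H_ALE_V_on_eq_0[OF J' H_ALE_V_on[OF J g]] by auto
  next
    case sub: True
    show ?thesis
    proof (cases "J = {}")
      case True
      then show ?thesis using sub H_ALE_V_on[OF J g] mean_V_on_empty by (simp add: H_ALE_empty)
    next
      case False
      define h where "h = L_ALE J g"
      have h: "h \<in> V" using V_L_ALE[OF g J False] by (simp add: h_def)
      have "H_ALE J g = (\<lambda>x. h x - (\<Sum>K | K \<subset> J. H_ALE K h x))"
        using H_ALE_nonempty[OF False J] by (simp add: h_def)
      moreover have "H_ALE J' (\<lambda>x. h x - (\<Sum>K | K \<subset> J. H_ALE K h x)) x =
          H_ALE J' h x - (\<Sum>K | K \<subset> J. H_ALE J' (H_ALE K h) x)" for x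
      proof -
        have V: "H_ALE K h \<in> V" if "K \<in> {K. K \<subset> J}" for K
          using that J H_ALE_V[OF _ h, of K] by auto
        show ?thesis
          using H_ALE_diff[OF J' h V_sum[OF finite_psubsets(1)[OF J] V]]
            H_ALE_sum[OF J' finite_psubsets(1)[OF J] V] by simp
      qed
      moreover have "(\<Sum>K | K \<subset> J. H_ALE J' (H_ALE K h) x) =
          (\<Sum>K | K \<subset> J. if J' = K then H_ALE K h x else 0)" for x
        using psubset.IH[OF _ _ J' h] J by (intro sum.cong) auto
      ultimately have "H_ALE J' (H_ALE J g) x = H_ALE J' h x - (if J' \<subset> J then H_ALE J' h x else 0)" for x
        using finite_psubsets(1)[OF J] by simp
      then show ?thesis
        using sub H_ALE_L_ALE[OF J False g] by (auto simp: h_def)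
    qed
  qed
qed

section \<open>Independent features\<close>

lemma override_X_measurable:
  assumes "J \<subseteq> D" "x \<in> rect D"
  shows "(\<lambda>\<omega>. override_on (X \<omega>) x J) \<in> M \<rightarrow>\<^sub>M (\<Pi>\<^sub>M j\<in>D. borel)"
proof (rule measurable_PiM_single')
  fix i assume i: "i \<in> D"
  have "(\<lambda>\<omega>. X \<omega> i) \<in> borel_measurable M"
    using measurable_compose[OF random_vector measurable_component_singleton[OF i]] .
  then show "(\<lambda>\<omega>. override_on (X \<omega>) x J i) \<in> borel_measurable M"
    by (cases "i \<in> J") auto
next
  have "X \<omega> \<in> extensional D" if "\<omega> \<in> space M" for \<omega>
    using measurable_space[OF random_vector that] by (auto simp: space_PiM PiE_iff)
  then show "(\<lambda>\<omega> i. override_on (X \<omega>) x J i) \<in> space M \<rightarrow> (\<Pi>\<^sub>E i\<in>D. space borel)"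
    using assms(1) by (auto simp: PiE_iff extensional_def override_on_def subset_iff)
qed

lemma X_extensional: "\<omega> \<in> space M \<Longrightarrow> i \<notin> D \<Longrightarrow> X \<omega> i = undefined"
  using measurable_space[OF random_vector, of \<omega>] by (auto simp: space_PiM PiE_iff extensional_def)

text \<open>Under independence \<open>\<kappa> J z\<close> is the unconditional law of the features
  outside \<open>J\<close>, so the integral transfers to \<open>M\<close> and becomes the marginal
  mean at any point of \<open>rect D\<close> extending \<open>z\<close>.\<close>

lemma cond_mean_independent:
  assumes "independent_features" "J \<subseteq> D" "x \<in> rect D" "z \<in> rect J"
    and "\<phi> \<in> borel_measurable (\<Pi>\<^sub>M j\<in>D. borel)"
  shows "cond_mean J \<phi> z = marg_mean J \<phi> (override_on x z J)"
proof -
  have k: "\<kappa> J z = distr M (\<Pi>\<^sub>M j\<in>D - J. borel) (\<lambda>\<omega>. restrict (X \<omega>) (D - J))"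
    by (rule kernel_independent[OF assms(1,2,4)])
  have "(\<lambda>\<omega>. restrict (X \<omega>) (D - J)) \<in> M \<rightarrow>\<^sub>M (\<Pi>\<^sub>M j\<in>D - J. borel)"
    by (rule measurable_compose[OF random_vector measurable_restrict_subset]) auto
  moreover have "(\<lambda>y. \<phi> (merge J (D - J) (z, y))) \<in> borel_measurable (\<Pi>\<^sub>M j\<in>D - J. borel)"
    using measurable_compose[OF merge_kernel_measurable[OF assms(2,4)] assms(5)] unfolding k by simp
  ultimately have "cond_mean J \<phi> z = expectation (\<lambda>\<omega>. \<phi> (merge J (D - J) (z, restrict (X \<omega>) (D - J))))"
    unfolding cond_mean_def k by (rule integral_distr)
  also have "\<dots> = expectation (\<lambda>\<omega>. \<phi> (override_on (X \<omega>) (override_on x z J) J))"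
  proof (rule Bochner_Integration.integral_cong[OF refl])
    fix \<omega> assume \<omega>: "\<omega> \<in> space M"
    \<comment> \<open>Outside \<open>D\<close> both sides are \<open>undefined\<close>: the left by
      \<open>merge\<close>, the right because \<open>X \<omega>\<close> is extensional.\<close>
    have "merge J (D - J) (z, restrict (X \<omega>) (D - J)) = override_on (X \<omega>) (override_on x z J) J"
      using X_extensional[OF \<omega>] assms(2) by (auto simp: merge_def override_on_def fun_eq_iff)
    then show "\<phi> (merge J (D - J) (z, restrict (X \<omega>) (D - J))) = \<phi> (override_on (X \<omega>) (override_on x z J) J)"
      by simp
  qed
  also have "\<dots> = marg_mean J \<phi> (override_on x z J)"
    by (rule marg_mean_eq[symmetric]) (intro rect_override[OF assms(3,2)] rectD[OF assms(4)])
  finally show ?thesis .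
qed

lemma xmin_rect: "restrict xmin D \<in> rect D"
  using xmin_less_xmax by (auto simp: rect_def less_imp_le)

text \<open>\<open>marg_mean J g\<close> depends on \<open>J\<close> alone, so conditioning its
  mixed derivative is evaluation. \<open>diff_exchange\<close> moves the derivative inside the mean,
  and independence turns that mean into the conditional mean of the mixed derivative of
  \<open>g\<close>.\<close>

lemma L_ALE_marg_mean:
  assumes "independent_features" "J \<subseteq> D" "g \<in> V"
  shows "L_ALE J (marg_mean J g) = L_ALE J g"
proof (rule L_ALE_eq_cong[OF assms(2)])
  fix z assume z: "z \<in> rect J"
  \<comment> \<open>The functions evaluated at this point depend only on \<open>J\<close>;
    \<open>xmin\<close> serves as an admissible value for the other coordinates.\<close>
  let ?y = "override_on (restrict xmin D) z J"
  have g': "marg_mean J g \<in> V" by (intro V_marg_mean assms)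
  have "cond_mean J (mixed_diff J (marg_mean J g)) z = mixed_diff J (marg_mean J g) ?y"
    by (intro cond_mean_depends_on mixed_diff_depends_on marg_mean_depends_on mixed_diff_measurable
        g' assms z xmin_rect)
  also have "\<dots> = marg_mean J (mixed_diff J g) ?y"
    by (simp add: diff_exchange[OF assms(3,2)])
  also have "\<dots> = cond_mean J (mixed_diff J g) z"
    by (intro cond_mean_independent[symmetric] mixed_diff_measurable assms z xmin_rect)
  finally show "cond_mean J (mixed_diff J (marg_mean J g)) z = cond_mean J (mixed_diff J g) z" .
qed

text \<open>A tower property. The inner mean averages the block \<open>B\<close>, after which the
  outer mean acts only on the block \<open>A\<close>. The blocks are independent, so their joint law
  is a product measure and Fubini joins the two averages into one over the complement of
  \<open>K\<close>.\<close>

lemma marg_mean_marg_mean: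
  assumes ind: "independent_features" and J: "K \<subseteq> J" "J \<subseteq> D" and g: "g \<in> V"
  shows "marg_mean K (marg_mean J g) = marg_mean K g"
proof (rule V_eqI)
  have K: "K \<subseteq> D" using J by auto
  show "marg_mean K (marg_mean J g) \<in> V" "marg_mean K g \<in> V"
    using V_marg_mean J K g by blast+
  fix x assume x: "x \<in> rect D"
  define A where "A = J - K"
  define B where "B = D - J"
  \<comment> \<open>\<open>A\<close>, \<open>B\<close> and \<open>K\<close> partition
    \<open>D\<close>, so \<open>c\<close> rebuilds a full point from samples of the two blocks and
    the fixed \<open>x\<close>; both sides become integrals of \<open>g\<close> at such
    points.\<close>
  define c where "c = (\<lambda>p i. override_on (merge A B p) x K i)"
  let ?P = "\<Pi>\<^sub>M j\<in>A. (borel :: real measure)" and ?Q = "\<Pi>\<^sub>M j\<in>B. (borel :: real measure)"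
  let ?U = "\<lambda>\<omega>. restrict (X \<omega>) A" and ?W = "\<lambda>\<omega>. restrict (X \<omega>) B"
  have AB: "A \<inter> B = {}" "A \<subseteq> D" "B \<subseteq> D" using J by (auto simp: A_def B_def)
  have c: "c \<in> ?P \<Otimes>\<^sub>M ?Q \<rightarrow>\<^sub>M (\<Pi>\<^sub>M j\<in>D. borel)"
    unfolding c_def
  proof (rule measurable_PiM_single')
    fix i assume "i \<in> D"
    show "(\<lambda>p. override_on (merge A B p) x K i) \<in> borel_measurable (?P \<Otimes>\<^sub>M ?Q)"
    proof (cases "i \<in> K")
      case False
      then have "i \<in> A \<union> B" using \<open>i \<in> D\<close> by (auto simp: A_def B_def)
      from measurable_compose[OF measurable_merge measurable_component_singleton[OF this, of "\<lambda>_. borel :: real measure"]]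
      show ?thesis using False by simp
    qed simp
  next
    have "override_on (merge A B p) x K i = undefined" if "i \<notin> D" for p i
      using that K AB by (cases p) (auto simp: override_on_def merge_def)
    then show "(\<lambda>p i. override_on (merge A B p) x K i) \<in> space (?P \<Otimes>\<^sub>M ?Q) \<rightarrow> (\<Pi>\<^sub>E i\<in>D. space borel)"
      by (auto simp: PiE_iff extensional_def)
  qed
  have gc: "(\<lambda>p. g (c p)) \<in> borel_measurable (?P \<Otimes>\<^sub>M ?Q)"
    by (rule measurable_compose[OF c V_measurable[OF g]])
  have iv: "indep_var ?P ?U ?Q ?W"
    using indep_var_restrict[OF ind AB] .
  have U: "?U \<in> M \<rightarrow>\<^sub>M ?P" and W: "?W \<in> M \<rightarrow>\<^sub>M ?Q"
    using iv by (auto dest: indep_var_rv1 indep_var_rv2)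
  have prod: "distr M ?P ?U \<Otimes>\<^sub>M distr M ?Q ?W = distr M (?P \<Otimes>\<^sub>M ?Q) (\<lambda>\<omega>. (?U \<omega>, ?W \<omega>))"
    using iv unfolding indep_var_distribution_eq by blast
  interpret PU: prob_space "distr M ?P ?U" by (rule prob_space_distr[OF U])
  interpret PW: prob_space "distr M ?Q ?W" by (rule prob_space_distr[OF W])
  interpret PP: pair_prob_space "distr M ?P ?U" "distr M ?Q ?W" ..
  obtain C where C: "\<And>x. \<bar>g x\<bar> \<le> C"
    using V_bounded[OF g] by (auto simp: bounded_iff)
  have int: "integrable (distr M ?P ?U \<Otimes>\<^sub>M distr M ?Q ?W) (\<lambda>p. g (c p))"
    using C gc by (intro PP.integrable_const_bound[where B = C]) (auto simp: measurable_distr_eq1)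
  \<comment> \<open>The two samples are kept apart: \<open>\<omega>\<close> from the outer mean
    contributes only its \<open>A\<close> block, \<open>\<omega>'\<close> from the inner mean only
    its \<open>B\<close> block.\<close>
  have split: "override_on (X \<omega>') (override_on (X \<omega>) x K) J = c (?U \<omega>, ?W \<omega>')"
    if "\<omega> \<in> space M" "\<omega>' \<in> space M" for \<omega> \<omega>'
    using X_extensional[OF that(1)] X_extensional[OF that(2)] J AB
    by (auto simp: c_def override_on_def merge_def A_def B_def fun_eq_iff)
  have inner: "(\<lambda>w. g (c (u, w))) \<in> borel_measurable ?Q" if "u \<in> space ?P" for u
    by (rule measurable_compose[OF measurable_Pair1'[OF that] gc])
  have "marg_mean K (marg_mean J g) x = expectation (\<lambda>\<omega>. marg_mean J g (override_on (X \<omega>) x K))"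
    by (rule marg_mean_eq[OF x])
  also have "\<dots> = expectation (\<lambda>\<omega>. (\<integral>w. g (c (?U \<omega>, w)) \<partial>distr M ?Q ?W))"
  proof (rule integral_cong_AE)
    show "(\<lambda>\<omega>. marg_mean J g (override_on (X \<omega>) x K)) \<in> borel_measurable M"
      using V_marg_mean[OF g J(2)] by (intro measurable_compose[OF override_X_measurable[OF K x] V_measurable])
    have "(\<lambda>u. \<integral>w. g (c (u, w)) \<partial>distr M ?Q ?W) \<in> borel_measurable ?P"
      using gc by (intro PW.borel_measurable_lebesgue_integral) (simp cong: measurable_cong_sets)
    then show "(\<lambda>\<omega>. \<integral>w. g (c (?U \<omega>, w)) \<partial>distr M ?Q ?W) \<in> borel_measurable M"
      by (rule measurable_compose[OF U])
    \<comment> \<open>The formula for \<open>marg_mean J g\<close> holds on \<open>rect D\<close>,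
      where \<open>X\<close> lies almost surely.\<close>
    show "AE \<omega> in M. marg_mean J g (override_on (X \<omega>) x K) = (\<integral>w. g (c (?U \<omega>, w)) \<partial>distr M ?Q ?W)"
      using X_in_rect AE_space
    proof eventually_elim
      case (elim \<omega>)
      have "marg_mean J g (override_on (X \<omega>) x K) =
          expectation (\<lambda>\<omega>'. g (override_on (X \<omega>') (override_on (X \<omega>) x K) J))"
        by (rule marg_mean_eq[OF rect_override_rect[OF x elim(1)]])
      also have "\<dots> = expectation (\<lambda>\<omega>'. g (c (?U \<omega>, ?W \<omega>')))"
        by (intro Bochner_Integration.integral_cong refl) (simp only: split[OF elim(2)])
      also have "\<dots> = (\<integral>w. g (c (?U \<omega>, w)) \<partial>distr M ?Q ?W)"
        using measurable_space[OF U elim(2)] by (intro integral_distr[symmetric] W inner)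
      finally show ?case .
    qed
  qed
  also have "\<dots> = (\<integral>u. (\<integral>w. g (c (u, w)) \<partial>distr M ?Q ?W) \<partial>distr M ?P ?U)"
    using gc by (intro integral_distr[symmetric] U PW.borel_measurable_lebesgue_integral) (simp cong: measurable_cong_sets)
  also have "\<dots> = (\<integral>p. g (c p) \<partial>(distr M ?P ?U \<Otimes>\<^sub>M distr M ?Q ?W))"
    by (rule PP.integral_fst'[OF int])
  also have "\<dots> = expectation (\<lambda>\<omega>. g (c (?U \<omega>, ?W \<omega>)))"
    unfolding prod by (intro integral_distr measurable_Pair U W gc)
  also have "\<dots> = expectation (\<lambda>\<omega>. g (override_on (X \<omega>) x K))"
  proof (intro Bochner_Integration.integral_cong refl)
    fix \<omega> assume "\<omega> \<in> space M"
    \<comment> \<open>The product law is that of both blocks of a single sample, so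
      \<open>split\<close> is used with equal samples; as \<open>K\<close> lies inside
      \<open>J\<close>, the double override then collapses.\<close>
    then have "c (?U \<omega>, ?W \<omega>) = override_on (X \<omega>) (override_on (X \<omega>) x K) J"
      using split by metis
    also have "\<dots> = override_on (X \<omega>) x K" using J by (auto simp: override_on_def fun_eq_iff)
    finally show "g (c (?U \<omega>, ?W \<omega>)) = g (override_on (X \<omega>) x K)" by simp
  qed
  also have "\<dots> = marg_mean K g x"
    by (rule marg_mean_eq[OF x, symmetric])
  finally show "marg_mean K (marg_mean J g) x = marg_mean K g x" .
qed

text \<open>For nonempty \<open>K\<close>, \<open>H_ALE K\<close> sees a function only through
  \<open>L_ALE K\<close>. As \<open>L_ALE K\<close> absorbs \<open>marg_mean K\<close>, and the
  tower property turns \<open>marg_mean K\<close> of \<open>marg_mean J g\<close> into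
  \<open>marg_mean K g\<close>, both sides agree. For empty \<open>K\<close> the tower property
  suffices, since \<open>mean\<close> is \<open>marg_mean {}\<close>.\<close>

lemma H_ALE_marg_mean:
  assumes "independent_features" "K \<subseteq> J" "J \<subseteq> D" "g \<in> V"
  shows "H_ALE K (marg_mean J g) = H_ALE K g"
proof -
  have K: "K \<subseteq> D" and g': "marg_mean J g \<in> V" using assms V_marg_mean by auto
  show ?thesis
  proof (cases "K = {}")
    case True
    have "marg_mean {} f = mean f" for f by (simp add: marg_mean_def mean_def)
    then show ?thesis
      using marg_mean_marg_mean[OF assms] True by (simp add: H_ALE_empty)
  next
    case False
    have "L_ALE K (marg_mean J g) = L_ALE K g"
      using L_ALE_marg_mean[OF assms(1) K g'] L_ALE_marg_mean[OF assms(1) K assms(4)]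
        marg_mean_marg_mean[OF assms] by simp
    then show ?thesis using False K by (simp add: H_ALE_nonempty)
  qed
qed

section \<open>The axioms of an interaction decomposition\<close>

lemma H_ALE_interaction_decomposition: "interaction_decomposition H_ALE"
  unfolding interaction_decomposition_def
proof (intro conjI)
  show "linear_family H_ALE"
    unfolding linear_family_def
    using H_ALE_V_on H_ALE_add H_ALE_lincomb[where b = 0] by auto
  show "unbiased H_ALE"
    unfolding unbiased_def
    using H_ALE_comp[of _ "{}"] by (auto simp: H_ALE_empty)
  show "relevant H_ALE"
    unfolding relevant_def using H_ALE_relevant by blast
  show "lean_decomposable H_ALE"
    unfolding lean_decomposable_def using H_ALE_lean by blast
  show "idempotent_family H_ALE"
    unfolding idempotent_family_def using H_ALE_comp by simp
  show "operationally_orthogonal H_ALE"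
    unfolding operationally_orthogonal_def using H_ALE_comp by simp
  show "consistent_with_PD H_ALE"
    unfolding consistent_with_PD_def
  proof (intro impI allI ballI ext)
    fix J g x
    assume ind: independent_features and J: "J \<subseteq> D" and g: "g \<in> V"
    have "marg_mean J g \<in> V_on J"
      using V_marg_mean[OF g J] marg_mean_depends_on by (simp add: V_on_iff)
    then have "marg_mean J g x = (\<Sum>J' | J' \<subseteq> J. H_ALE J' (marg_mean J g) x)"
      by (rule H_ALE_lean[OF J, symmetric])
    also have "\<dots> = (\<Sum>J' | J' \<subseteq> J. H_ALE J' g x)"
      using H_ALE_marg_mean[OF ind _ J g] by simp
    finally show "(\<Sum>J' | J' \<subseteq> J. H_ALE J' g x) = marg_mean J g x" ..
  qed
qed

end

theorem proposition5:
  fixes M :: "'a measure" and d :: nat and X :: "'a \<Rightarrow> nat \<Rightarrow> real"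
    and xmin xmax :: "nat \<Rightarrow> real"
    and \<kappa> :: "nat set \<Rightarrow> (nat \<Rightarrow> real) \<Rightarrow> (nat \<Rightarrow> real) measure"
    and V :: "((nat \<Rightarrow> real) \<Rightarrow> real) set"
  assumes "ale_setting M d X xmin xmax \<kappa> V"
  shows "ale_setting.interaction_decomposition M d X xmin xmax V
           (feature_model.H_ALE M d X xmin xmax \<kappa>)"
  using assms by (rule ale_setting.H_ALE_interaction_decomposition)

end
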